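(* Lattices $\Lambda,\Lambda'\subset\mathbb{R}^2$ are similar (related by an isometry composed with a uniform scaling) if and only if $\mathrm{PI}(\Lambda)=\mathrm{PI}(\Lambda')$. The lattices $\Lambda,\Lambda'$ are related by an orientation-preserving similarity if and only if $\mathrm{PI}^o(\Lambda)=\mathrm{PI}^o(\Lambda')$.
   Context: A lattice $\Lambda\subset\mathbb{R}^2$ is the set of all integer linear combinations of a linear basis of $\mathbb{R}^2$. A similarity is a composition of an isometry of $\mathbb{R}^2$ and a uniform scaling $v\mapsto sv$ with $s>0$; it is orientation-preserving if the isometry is. A superbase of $\Lambda$ is a triple $B=\{v_0,v_1,v_2\}$, where $v_1,v_2$ is a basis generating $\Lambda$ and $v_0=-v_1-v_2$. It is obtuse if all conorms $p_{ij}=-v_i\cdot v_j$ ($i\neq j$) are $\geq 0$. Every lattice in $\mathbb{R}^2$ has an obtuse superbase. The root invariant $\mathrm{RI}(\Lambda)=(r_{12},r_{01},r_{02})$, $r_{12}\leq r_{01}\leq r_{02}$, is the triple of the root products $\sqrt{p_{ij}}$ of an obtuse superbase of $\Lambda$ in increasing order (independent of the choice of obtuse superbase). A lattice is mirror-symmetric if it is mapped to itself by a reflection in a line; then $\mathrm{sign}(\Lambda)=0$. Otherwise the vectors of an obtuse superbase have three different lengths; let $v_1,v_2$ be the two shortest, with $|v_1|<|v_2|$, and let $\mathrm{sign}(\Lambda)=\pm1$ be the sign of $\det(v_1,v_2)$ (independent of the choice of obtuse superbase). Put $\bar r_{ij}=r_{ij}/(r_{12}+r_{01}+r_{02})$.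 The projected invariant is $\mathrm{PI}(\Lambda)=(x,y)$ with $x=\bar r_{02}-\bar r_{01}$ and $y=3\bar r_{12}$. The oriented projected invariant $\mathrm{PI}^o(\Lambda)$ is the pair consisting of $\mathrm{PI}(\Lambda)$ and $\mathrm{sign}(\Lambda)$. *)

theory Defs
  imports "HOL-Analysis.Analysis"
begin

definition int_combinations :: "real^2 \<Rightarrow> real^2 \<Rightarrow> (real^2) set" where
  "int_combinations v w = {of_int a *\<^sub>R v + of_int b *\<^sub>R w | a b :: int. True}"

definition linear_basis :: "real^2 \<Rightarrow> real^2 \<Rightarrow> bool" where
  "linear_basis v w \<longleftrightarrow> v \<noteq> w \<and> independent {v, w} \<and> span {v, w} = UNIV"

definition planar_lattice :: "(real^2) set \<Rightarrow> bool" where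
  "planar_lattice \<Lambda> \<longleftrightarrow> (\<exists>v w. linear_basis v w \<and> \<Lambda> = int_combinations v w)"

definition isometry :: "(real^2 \<Rightarrow> real^2) \<Rightarrow> bool" where
  "isometry g \<longleftrightarrow> (\<forall>x y. dist (g x) (g y) = dist x y)"

(* An isometry g of the plane is affine, so \<lambda>x. g x - g 0 is its linear part. *)
definition orientation_preserving_isometry :: "(real^2 \<Rightarrow> real^2) \<Rightarrow> bool" where
  "orientation_preserving_isometry g \<longleftrightarrow>
     isometry g \<and> rotation_matrix (matrix (\<lambda>x. g x - g 0))"

definition similarity :: "(real^2 \<Rightarrow> real^2) \<Rightarrow> bool" where
  "similarity f \<longleftrightarrow> (\<exists>g s. isometry g \<and> s > 0 \<and> f = g \<circ> (\<lambda>v. s *\<^sub>R v))"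

definition orientation_preserving_similarity :: "(real^2 \<Rightarrow> real^2) \<Rightarrow> bool" where
  "orientation_preserving_similarity f \<longleftrightarrow>
     (\<exists>g s. orientation_preserving_isometry g \<and> s > 0 \<and> f = g \<circ> (\<lambda>v. s *\<^sub>R v))"

definition similar_lattices :: "(real^2) set \<Rightarrow> (real^2) set \<Rightarrow> bool" where
  "similar_lattices \<Lambda> \<Lambda>' \<longleftrightarrow> (\<exists>f. similarity f \<and> f ` \<Lambda> = \<Lambda>')"

definition oriented_similar_lattices :: "(real^2) set \<Rightarrow> (real^2) set \<Rightarrow> bool" where
  "oriented_similar_lattices \<Lambda> \<Lambda>' \<longleftrightarrow>
     (\<exists>f. orientation_preserving_similarity f \<and> f ` \<Lambda> = \<Lambda>')"

(* Superbases are kept as labelled triples. The predicates superbase and obtuse_superbase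
   are invariant under permuting the labels, so a condition "for some superbase" leaves the
   labelling free. *)
definition superbase :: "(real^2) set \<Rightarrow> real^2 \<Rightarrow> real^2 \<Rightarrow> real^2 \<Rightarrow> bool" where
  "superbase \<Lambda> v0 v1 v2 \<longleftrightarrow>
     linear_basis v1 v2 \<and> \<Lambda> = int_combinations v1 v2 \<and> v0 = - v1 - v2"

definition conorm :: "real^2 \<Rightarrow> real^2 \<Rightarrow> real" where
  "conorm v w = - (v \<bullet> w)"

definition obtuse_superbase :: "(real^2) set \<Rightarrow> real^2 \<Rightarrow> real^2 \<Rightarrow> real^2 \<Rightarrow> bool" where
  "obtuse_superbase \<Lambda> v0 v1 v2 \<longleftrightarrow>
     superbase \<Lambda> v0 v1 v2 \<and> conorm v1 v2 \<ge> 0 \<and> conorm v0 v1 \<ge> 0 \<and> conorm v0 v2 \<ge> 0"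

definition root_product :: "real^2 \<Rightarrow> real^2 \<Rightarrow> real" where
  "root_product v w = sqrt (conorm v w)"

(* The result (r12, r01, r02) is in increasing order, and so does not depend on
   the labelling of the superbase. *)
definition root_invariant :: "(real^2) set \<Rightarrow> real \<times> real \<times> real" where
  "root_invariant \<Lambda> = (THE (r12, r01, r02). \<exists>v0 v1 v2. obtuse_superbase \<Lambda> v0 v1 v2 \<and>
     [r12, r01, r02] = sort [root_product v1 v2, root_product v0 v1, root_product v0 v2])"

(* Reflection in the line through p orthogonal to n, for n \<noteq> 0. *)
definition line_reflection :: "real^2 \<Rightarrow> real^2 \<Rightarrow> real^2 \<Rightarrow> real^2" where
  "line_reflection p n x = x - (2 * ((x - p) \<bullet> n) / (n \<bullet> n)) *\<^sub>R n"

definition mirror_symmetric :: "(real^2) set \<Rightarrow> bool" where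
  "mirror_symmetric \<Lambda> \<longleftrightarrow> (\<exists>p n. n \<noteq> 0 \<and> line_reflection p n ` \<Lambda> = \<Lambda>)"

definition lattice_sign :: "(real^2) set \<Rightarrow> real" where
  "lattice_sign \<Lambda> =
     (if mirror_symmetric \<Lambda> then 0
      else (THE s. \<exists>v0 v1 v2. obtuse_superbase \<Lambda> v0 v1 v2 \<and>
              norm v1 < norm v2 \<and> norm v2 < norm v0 \<and>
              s = sgn (det (vector [v1, v2] :: real^2^2))))"

definition projected_invariant :: "(real^2) set \<Rightarrow> real \<times> real" where
  "projected_invariant \<Lambda> =
     (case root_invariant \<Lambda> of (r12, r01, r02) \<Rightarrow>
        let \<sigma> = r12 + r01 + r02
        in (r02 / \<sigma> - r01 / \<sigma>, 3 * (r12 / \<sigma>)))"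

definition oriented_projected_invariant :: "(real^2) set \<Rightarrow> (real \<times> real) \<times> real" where
  "oriented_projected_invariant \<Lambda> = (projected_invariant \<Lambda>, lattice_sign \<Lambda>)"

end

(* Selling's formula writes the squared length of a lattice vector as a nonnegative combination of
   the conorms of an obtuse superbase. Summed over the three vectors of any other superbase it shows
   that obtuse superbases are exactly those of least total squared length; comparing coefficients in
   the case of equality leaves finitely many integral changes of superbase, all of which preserve the
   conorms up to order. So the invariants are well defined, and the projected invariant determines
   the ordered conorms up to a common factor. Matching two ordered obtuse superbases with
   proportional conorms yields a linear similarity, whose determinant has the sign prescribed by the
   two lattice signs; for mirror-symmetric lattices a reflection corrects the orientation. *)
theory Submission
  imports Defs
begin

text \<open>Comparing coefficients says nothing about a conorm that vanishes. The squared
  determinant of a superbase is the sum of the pairwise products of its conorms, so at most one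
  conorm of an obtuse superbase is zero. In general 12 integral changes remain: the permutations of
  the three vectors, with a common sign. If two vectors are orthogonal, 12 more appear, coming from
  the second obtuse superbase obtained by reversing one of these two vectors. The squared length of
  each vector is the sum of the two conorms at it, so ordering the conorms also orders the lengths.
  When the lengths differ, their order excludes every nontrivial permutation, and the remaining
  common sign is harmless because \<open>-id\<close> has determinant 1 in the plane; hence the sign
  is well defined. Similarities need not fix the origin, but they send it to a vector of the target
  lattice, and translating back by that vector preserves the lattice. This reduces everything to
  linear maps.\<close>

section \<open>Determinants and bases of the plane\<close>

definition det2 :: "real^2 \<Rightarrow> real^2 \<Rightarrow> real" where
  "det2 v w = v $ 1 * w $ 2 - v $ 2 * w $ 1"

lemma det_vector_2: "det (vector [v, w] :: real^2^2) = det2 v w"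
  by (simp add: det_2 det2_def vector_2 mult.commute)

lemma det2_combination:
  "det2 (a *\<^sub>R v + b *\<^sub>R w) (c *\<^sub>R v + d *\<^sub>R w) = (a * d - b * c) * det2 v w"
  by (simp add: det2_def algebra_simps)

lemma inner_real2: "(v :: real^2) \<bullet> w = v $ 1 * w $ 1 + v $ 2 * w $ 2"
  by (simp add: inner_vec_def sum_2)

lemma vec_eq_iff_2: "(v :: real^2) = w \<longleftrightarrow> v $ 1 = w $ 1 \<and> v $ 2 = w $ 2"
  by (auto simp: vec_eq_iff forall_2)

lemma det2_sq: "(det2 v w)\<^sup>2 = (v \<bullet> v) * (w \<bullet> w) - (v \<bullet> w)\<^sup>2"
  by (simp add: det2_def inner_real2 power2_eq_square algebra_simps)

text \<open>Cramer's rule is kept free of division so that it survives a zero determinant, where it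
  becomes a linear relation between \<open>v\<close> and \<open>w\<close> for every choice of
  \<open>x\<close>.\<close>

lemma cramer_2: "det2 v w *\<^sub>R x = det2 x w *\<^sub>R v + det2 v x *\<^sub>R w"
  by (simp add: vec_eq_iff_2 det2_def algebra_simps)

lemma linear_basis_iff_det2: "linear_basis v w \<longleftrightarrow> det2 v w \<noteq> 0"
proof
  assume L: "linear_basis v w"
  show "det2 v w \<noteq> 0"
  proof
    assume "det2 v w = 0"
    then have 0: "\<And>x. det2 x w *\<^sub>R v + det2 v x *\<^sub>R w = 0"
      using cramer_2[of v w] by simp
    have i: "independent {v, w}" "v \<noteq> w"
      using L by (auto simp: linear_basis_def)
    have "det2 v x = 0" for x
    proof (rule ccontr)
      assume n: "det2 v x \<noteq> 0"
      then have "w = (- (det2 x w / det2 v x)) *\<^sub>R v"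
        using 0[of x] by (simp add: vec_eq_iff_2 field_simps)
      then have "w \<in> span {v}"
        by (metis span_base span_mul singletonI)
      then show False
        using i by (simp add: independent_insert insert_commute[of v w] split: if_splits)
    qed
    \<comment> \<open>The quarter turn of \<open>v\<close> pairs with \<open>v\<close> under
      \<open>det2\<close> to give the squared length of \<open>v\<close>.\<close>
    from this[of "vector [- (v $ 2), v $ 1]"] have "v $ 1 * v $ 1 + v $ 2 * v $ 2 = 0"
      by (simp add: det2_def vector_2)
    then have "v = 0"
      by (simp add: vec_eq_iff_2 sum_squares_eq_zero_iff)
    then show False
      using i dependent_zero by blast
  qed
next
  assume D: "det2 v w \<noteq> 0"
  then have ne: "v \<noteq> w"
    by (auto simp: det2_def)
  have *: "x \<in> span {v, w}" for x
  proof -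
    have "x = (1 / det2 v w) *\<^sub>R (det2 v w *\<^sub>R x)"
      using D by simp
    also have "\<dots> \<in> span {v, w}"
      by (subst cramer_2) (intro span_mul span_add span_base; simp)
    finally show ?thesis .
  qed
  then have U: "span {v, w} = UNIV"
    by blast
  have "independent {v, w}"
    by (rule card_le_dim_spanning[of _ UNIV]) (use U ne in auto)
  then show "linear_basis v w"
    using ne U by (simp add: linear_basis_def)
qed

section \<open>Lattices and superbases\<close>

lemma int_combinations_iff:
  "x \<in> int_combinations v w \<longleftrightarrow> (\<exists>a b :: int. x = of_int a *\<^sub>R v + of_int b *\<^sub>R w)"
  by (auto simp: int_combinations_def)

lemma int_combinations_closed:
  assumes "x \<in> int_combinations v w" "y \<in> int_combinations v w"
  shows "of_int m *\<^sub>R x + of_int n *\<^sub>R y \<in> int_combinations v w"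
proof -
  obtain a b c d :: int where "x = of_int a *\<^sub>R v + of_int b *\<^sub>R w"
    "y = of_int c *\<^sub>R v + of_int d *\<^sub>R w"
    using assms by (auto simp: int_combinations_iff)
  then have "of_int m *\<^sub>R x + of_int n *\<^sub>R y =
      of_int (m * a + n * c) *\<^sub>R v + of_int (m * b + n * d) *\<^sub>R w"
    by (simp add: algebra_simps)
  then show ?thesis
    unfolding int_combinations_iff by blast
qed

lemma int_combinations_subset:
  assumes "x \<in> int_combinations v w" "y \<in> int_combinations v w"
  shows "int_combinations x y \<subseteq> int_combinations v w"
  using int_combinations_closed[OF assms] by (auto simp: int_combinations_iff)

lemma int_combinations_basis: "v \<in> int_combinations v w" "w \<in> int_combinations v w"
proof -
  have "v = of_int 1 *\<^sub>R v + of_int 0 *\<^sub>R w" "w = of_int 0 *\<^sub>R v + of_int 1 *\<^sub>R w"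
    by auto
  then show "v \<in> int_combinations v w" "w \<in> int_combinations v w"
    unfolding int_combinations_iff by blast+
qed

lemma superbase_iff:
  "superbase \<Lambda> v0 v1 v2 \<longleftrightarrow> det2 v1 v2 \<noteq> 0 \<and> \<Lambda> = int_combinations v1 v2 \<and> v0 = - v1 - v2"
  by (simp add: superbase_def linear_basis_iff_det2)

text \<open>An integral matrix of determinant e = 1 or -1 has the integral inverse e times its
  adjugate. Working with e * e = 1 treats both signs at once.\<close>

lemma int_combinations_eqI:
  assumes "x = of_int a *\<^sub>R v + of_int b *\<^sub>R w" "y = of_int c *\<^sub>R v + of_int d *\<^sub>R w"
    and "a * d - b * c = 1 \<or> a * d - b * c = -1"
  shows "int_combinations x y = int_combinations v w"
proof
  let ?e = "a * d - b * c"
  show "int_combinations x y \<subseteq> int_combinations v w"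
    by (rule int_combinations_subset) (use assms in \<open>auto simp: int_combinations_iff\<close>)
  have "?e * ?e = 1"
    using assms(3) by (elim disjE) simp_all
  then have e: "of_int (?e * ?e) = (1 :: real)"
    by (metis of_int_1)
  have "of_int (?e * ?e) *\<^sub>R v = of_int (?e * d) *\<^sub>R x + of_int (- ?e * b) *\<^sub>R y"
       "of_int (?e * ?e) *\<^sub>R w = of_int (- ?e * c) *\<^sub>R x + of_int (?e * a) *\<^sub>R y"
    by (simp_all add: vec_eq_iff_2 assms(1,2) algebra_simps)
  then have "v = of_int (?e * d) *\<^sub>R x + of_int (- ?e * b) *\<^sub>R y"
       "w = of_int (- ?e * c) *\<^sub>R x + of_int (?e * a) *\<^sub>R y"
    unfolding e scaleR_one .
  then show "int_combinations v w \<subseteq> int_combinations x y"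
    by (intro int_combinations_subset) (unfold int_combinations_iff, blast+)
qed

text \<open>\<open>superbase\<close> treats \<open>v0\<close> differently from the other two
  vectors; this transposition and the next generate all relabellings.\<close>

lemma superbase_swap12: "superbase \<Lambda> v0 v1 v2 \<Longrightarrow> superbase \<Lambda> v0 v2 v1"
  using int_combinations_eqI[of v2 0 v1 1 v2 v1 1 0]
  by (simp add: superbase_iff det2_def mult.commute)

lemma superbase_swap01:
  assumes "superbase \<Lambda> v0 v1 v2" shows "superbase \<Lambda> v1 v0 v2"
proof -
  have "int_combinations v0 v2 = int_combinations v1 v2"
    using assms by (intro int_combinations_eqI[of v0 "-1" v1 "-1" v2 v2 0 1]) (auto simp: superbase_iff)
  moreover have v0: "v0 = - v1 - v2"
    using assms by (simp add: superbase_iff)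
  have "det2 v0 v2 = - det2 v1 v2" "v1 = - v0 - v2"
    unfolding v0 by (simp_all add: det2_def algebra_simps)
  ultimately show ?thesis
    using assms by (simp add: superbase_iff)
qed

text \<open>The step of Selling's reduction: one vector is reversed, one is kept. It lowers the
  total squared length when \<open>conorm v1 v2\<close> is negative, and it exhibits a reflection of
  the lattice when \<open>v1\<close> and \<open>v2\<close> are orthogonal.\<close>

lemma superbase_flip: "superbase \<Lambda> v0 v1 v2 \<Longrightarrow> superbase \<Lambda> (v1 - v2) (- v1) v2"
  using int_combinations_eqI[of "- v1" "-1" v1 0 v2 v2 0 1] by (simp add: superbase_iff det2_def)

lemma conorm_commute: "conorm v w = conorm w v"
  by (simp add: conorm_def inner_commute)

lemma obtuse_superbase_swap12: "obtuse_superbase \<Lambda> v0 v1 v2 \<Longrightarrow> obtuse_superbase \<Lambda> v0 v2 v1"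
  using superbase_swap12 by (auto simp: obtuse_superbase_def conorm_commute)

lemma obtuse_superbase_swap01: "obtuse_superbase \<Lambda> v0 v1 v2 \<Longrightarrow> obtuse_superbase \<Lambda> v1 v0 v2"
  using superbase_swap01 by (auto simp: obtuse_superbase_def conorm_commute)

text \<open>Selling's formula in polarised form: the conorm of two superbase vectors is weighted by
  the product of the differences of their coefficients, where \<open>v0\<close> has coefficient
  0.\<close>

lemma selling_inner:
  assumes "v0 = - v1 - v2"
  shows "(a *\<^sub>R v1 + b *\<^sub>R v2) \<bullet> (c *\<^sub>R v1 + d *\<^sub>R v2) =
    a * c * conorm v0 v1 + b * d * conorm v0 v2 + (a - b) * (c - d) * conorm v1 v2"
  by (simp add: assms conorm_def inner_add_left inner_add_right inner_diff_left inner_diff_right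
      inner_commute[of v2 v1] algebra_simps)

section \<open>Existence of obtuse superbases\<close>

text \<open>By Cramer's rule a coordinate of \<open>x\<close> is a quotient of determinants, and
  \<open>det2_sq\<close> bounds the numerator by the product of the lengths. So the integral
  coordinates lie in a bounded square.\<close>

lemma finite_lattice_ball:
  assumes "det2 v w \<noteq> 0"
  shows "finite {x \<in> int_combinations v w. x \<bullet> x \<le> C}"
proof -
  define M where "M = max (C * (w \<bullet> w) / (det2 v w)\<^sup>2) (C * (v \<bullet> v) / (det2 v w)\<^sup>2)"
  have M: "C * (w \<bullet> w) / (det2 v w)\<^sup>2 \<le> M" "C * (v \<bullet> v) / (det2 v w)\<^sup>2 \<le> M"
    by (simp_all add: M_def)
  define N where "N = max 0 \<lceil>M\<rceil>"
  have N: "M \<le> of_int N" "0 \<le> N"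
    by (auto simp: N_def le_max_iff_disj of_int_max)
  have fin: "finite ((\<lambda>(a, b). of_int a *\<^sub>R v + of_int b *\<^sub>R w) ` ({-N..N} \<times> {-N..N}))"
    by simp
  have bd: "a \<in> {-N..N}" if "(of_int a)\<^sup>2 * (det2 v w)\<^sup>2 \<le> C * q"
    and "C * q / (det2 v w)\<^sup>2 \<le> M" for a :: int and q :: real
  proof -
    have "(of_int a)\<^sup>2 \<le> C * q / (det2 v w)\<^sup>2"
      using that(1) assms by (simp add: field_simps)
    then have "of_int (a\<^sup>2) \<le> (of_int N :: real)"
      using that(2) N unfolding of_int_power by linarith
    then have "a\<^sup>2 \<le> N"
      by (simp only: of_int_le_iff)
    \<comment> \<open>For integers a bound on the square already bounds the number itself, so no
      square root of the bound is taken.\<close>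
    moreover have "\<bar>a\<bar> \<le> a\<^sup>2"
      using mult_left_mono[of 1 "\<bar>a\<bar>" "\<bar>a\<bar>"] by (cases "a = 0") (auto simp: power2_eq_square)
    ultimately show ?thesis
      by auto
  qed
  have "{x \<in> int_combinations v w. x \<bullet> x \<le> C} \<subseteq>
      (\<lambda>(a, b). of_int a *\<^sub>R v + of_int b *\<^sub>R w) ` ({-N..N} \<times> {-N..N})"
  proof
    fix x assume "x \<in> {x \<in> int_combinations v w. x \<bullet> x \<le> C}"
    then obtain a b :: int where x: "x = of_int a *\<^sub>R v + of_int b *\<^sub>R w" and le: "x \<bullet> x \<le> C"
      by (auto simp: int_combinations_iff)
    have "(det2 x w)\<^sup>2 \<le> C * (w \<bullet> w)"
      using mult_right_mono[OF le inner_ge_zero[of w]] zero_le_power2[of "x \<bullet> w"]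
      unfolding det2_sq by linarith
    moreover have "(det2 v x)\<^sup>2 \<le> C * (v \<bullet> v)"
      using mult_right_mono[OF le inner_ge_zero[of v]] zero_le_power2[of "v \<bullet> x"]
      unfolding det2_sq mult.commute[of "v \<bullet> v"] by linarith
    moreover have "det2 x w = of_int a * det2 v w" "det2 v x = of_int b * det2 v w"
      by (simp_all add: x det2_def algebra_simps)
    ultimately have "a \<in> {-N..N}" "b \<in> {-N..N}"
      using bd[OF _ M(1)] bd[OF _ M(2)] by (simp_all add: power_mult_distrib)
    then show "x \<in> (\<lambda>(a, b). of_int a *\<^sub>R v + of_int b *\<^sub>R w) ` ({-N..N} \<times> {-N..N})"
      using x by auto
  qed
  then show ?thesis
    using fin finite_subset by blast
qed

definition energy :: "real^2 \<Rightarrow> real^2 \<Rightarrow> real^2 \<Rightarrow> real" where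
  "energy v0 v1 v2 = v0 \<bullet> v0 + v1 \<bullet> v1 + v2 \<bullet> v2"

text \<open>Flipping \<open>v1\<close> only replaces the length of \<open>v1 + v2\<close> by that of
  \<open>v1 - v2\<close>, which changes the energy by exactly 4 times
  \<open>conorm v1 v2\<close>.\<close>

lemma minimal_superbase_conorm_nonneg:
  assumes "superbase \<Lambda> v0 v1 v2"
    and "\<And>w0 w1 w2. superbase \<Lambda> w0 w1 w2 \<Longrightarrow> energy v0 v1 v2 \<le> energy w0 w1 w2"
  shows "conorm v1 v2 \<ge> 0"
proof -
  from assms(2)[OF superbase_flip[OF assms(1)]] show ?thesis
    using assms(1)
    by (simp add: energy_def superbase_iff conorm_def inner_add_left inner_add_right inner_diff_left
        inner_diff_right inner_commute[of v2 v1])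
qed

lemma obtuse_superbase_exists:
  assumes "planar_lattice \<Lambda>"
  obtains v0 v1 v2 where "obtuse_superbase \<Lambda> v0 v1 v2"
proof -
  obtain v w where vw: "superbase \<Lambda> (- v - w) v w"
    using assms by (auto simp: planar_lattice_def superbase_def)
  define C where "C = energy (- v - w) v w"
  \<comment> \<open>The energy cutoff of an initial superbase makes the set of candidates finite, so
    that a minimum exists; superbases above the cutoff cannot do better.\<close>
  define S where "S = {(x, y). superbase \<Lambda> (- x - y) x y \<and> energy (- x - y) x y \<le> C}"
  let ?B = "{x \<in> \<Lambda>. x \<bullet> x \<le> C}"
  have "finite ?B"
    using vw finite_lattice_ball by (auto simp: superbase_iff)
  moreover have "S \<subseteq> ?B \<times> ?B"
  proof
    fix z assume "z \<in> S"
    then obtain x y where z: "z = (x, y)" "superbase \<Lambda> (- x - y) x y" "energy (- x - y) x y \<le> C"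
      by (auto simp: S_def)
    then have "x \<bullet> x \<le> C" "y \<bullet> y \<le> C"
      using inner_ge_zero[of x] inner_ge_zero[of y] inner_ge_zero[of "- x - y"]
      unfolding energy_def by linarith+
    then show "z \<in> ?B \<times> ?B"
      using z int_combinations_basis by (simp add: superbase_iff)
  qed
  ultimately have "finite S"
    by (meson finite_SigmaI finite_subset)
  moreover have "(v, w) \<in> S"
    using vw by (simp add: S_def C_def)
  moreover define m where "m = arg_min_on (\<lambda>(x, y). energy (- x - y) x y) S"
  ultimately have m: "m \<in> S" "\<And>z. z \<in> S \<Longrightarrow>
      (\<lambda>(x, y). energy (- x - y) x y) m \<le> (\<lambda>(x, y). energy (- x - y) x y) z"
    using arg_min_if_finite(1)[of S] arg_min_least[of S _ "\<lambda>(x, y). energy (- x - y) x y"] by blast+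
  obtain x y where xy: "m = (x, y)"
    by force
  have sb: "superbase \<Lambda> (- x - y) x y"
    using m(1) by (simp add: xy S_def)
  have min: "energy (- x - y) x y \<le> energy w0 w1 w2" if "superbase \<Lambda> w0 w1 w2" for w0 w1 w2
  proof (cases "energy w0 w1 w2 \<le> C")
    case True
    then show ?thesis
      using m(2)[of "(w1, w2)"] that by (simp add: xy S_def superbase_iff)
  next
    case False
    then show ?thesis
      using m(1) by (simp add: xy S_def)
  qed
  have "conorm x y \<ge> 0"
    using minimal_superbase_conorm_nonneg[OF sb] min by blast
  \<comment> \<open>Energy is symmetric in the labels, so each pair of vectors can take the place of
    \<open>v1, v2\<close>.\<close>
  moreover have "conorm (- x - y) y \<ge> 0"
    using minimal_superbase_conorm_nonneg[OF superbase_swap01[OF sb]] min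
    by (simp add: energy_def add.commute add.left_commute)
  moreover have "conorm (- x - y) x \<ge> 0"
    using minimal_superbase_conorm_nonneg[OF superbase_swap01[OF superbase_swap12[OF sb]]] min
    by (simp add: energy_def add.commute add.left_commute)
  ultimately have "obtuse_superbase \<Lambda> (- x - y) x y"
    using sb by (simp add: obtuse_superbase_def)
  then show ?thesis
    using that by blast
qed

section \<open>Uniqueness of obtuse superbases\<close>

lemma superbase_coordinates:
  assumes "superbase \<Lambda> v0 v1 v2" "superbase \<Lambda> w0 w1 w2"
  obtains a b c d :: int where "w1 = of_int a *\<^sub>R v1 + of_int b *\<^sub>R v2"
    "w2 = of_int c *\<^sub>R v1 + of_int d *\<^sub>R v2" "a * d - b * c \<noteq> 0"
proof -
  have "w1 \<in> \<Lambda>" "w2 \<in> \<Lambda>"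
    using assms(2) int_combinations_basis by (auto simp: superbase_iff)
  then obtain a b c d :: int where w: "w1 = of_int a *\<^sub>R v1 + of_int b *\<^sub>R v2"
    "w2 = of_int c *\<^sub>R v1 + of_int d *\<^sub>R v2"
    using assms(1) by (auto simp: superbase_iff int_combinations_iff)
  have "det2 w1 w2 = of_int (a * d - b * c) * det2 v1 v2"
    by (simp add: w det2_combination)
  moreover have "det2 w1 w2 \<noteq> 0"
    using assms(2) by (simp add: superbase_iff)
  ultimately have "a * d - b * c \<noteq> 0"
    by fastforce
  with w show ?thesis
    using that by blast
qed

text \<open>The pair \<open>(a, c)\<close> stands for the vector \<open>(- a - c, a, c)\<close> of the root system
  \<open>A\<^sub>2\<close>: the
  \<open>v1\<close>-coordinates of \<open>w0, w1, w2\<close> have sum zero, and so do the \<open>v2\<close>-coordinates.\<close>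

definition A2_roots :: "(int \<times> int) set" where
  "A2_roots = {(1, 0), (-1, 0), (0, 1), (0, -1), (1, -1), (-1, 1)}"

text \<open>A nonzero integer vector of sum zero has at least two nonzero entries. The bound 2 is
  the squared length of a root.\<close>

lemma sum_zero_squares_ge_2:
  fixes a c :: int
  assumes "a \<noteq> 0 \<or> c \<noteq> 0"
  shows "2 \<le> a\<^sup>2 + c\<^sup>2 + (a + c)\<^sup>2"
proof -
  have *: "x \<noteq> 0 \<Longrightarrow> 1 \<le> x\<^sup>2" for x :: int
    by (simp add: int_one_le_iff_zero_less)
  show ?thesis
  proof (cases "a = 0 \<or> c = 0")
    case True
    then show ?thesis
      using assms *[of a] *[of c] by auto
  next
    case False
    then show ?thesis
      using *[of a] *[of c] zero_le_power2[of "a + c"] by linarith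
  qed
qed

lemma sum_zero_squares_eq_2:
  fixes a c :: int
  assumes "a\<^sup>2 + c\<^sup>2 + (a + c)\<^sup>2 = 2"
  shows "(a, c) \<in> A2_roots"
proof -
  have *: "x \<in> {-1, 0, 1}" if "x\<^sup>2 \<le> 2" for x :: int
  proof -
    have "x\<^sup>2 < 2\<^sup>2"
      using that by simp
    then have "\<bar>x\<bar> < 2"
      by (metis abs_numeral power2_less_imp_less abs_ge_zero power2_abs zero_le_numeral)
    then show ?thesis
      by auto
  qed
  have "a\<^sup>2 \<le> 2" "c\<^sup>2 \<le> 2"
    using assms zero_le_power2[of a] zero_le_power2[of c] zero_le_power2[of "a + c"] by linarith+
  then have "a \<in> {-1, 0, 1}" "c \<in> {-1, 0, 1}"
    using * by blast+
  then show ?thesis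
    using assms by (auto simp: A2_roots_def)
qed

text \<open>Each of the 6 roots is independent of 4 others, which gives 24 pairs. Listing them turns
  later arguments into evaluations.\<close>

lemma A2_roots_independent:
  assumes "(a, c) \<in> A2_roots" "(b, d) \<in> A2_roots" "a * d - b * c \<noteq> 0"
  shows "(a, b, c, d) \<in>
    {(1, 0, 0, 1), (1, 0, 0, -1), (1, 1, 0, -1), (1, -1, 0, 1), (-1, 0, 0, 1), (-1, 0, 0, -1),
     (-1, 1, 0, -1), (-1, -1, 0, 1), (0, 1, 1, 0), (0, -1, 1, 0), (0, 1, 1, -1), (0, -1, 1, 1),
     (0, 1, -1, 0), (0, -1, -1, 0), (0, 1, -1, -1), (0, -1, -1, 1), (1, 1, -1, 0), (1, -1, -1, 0),
     (1, 0, -1, 1), (1, 0, -1, -1), (-1, 1, 1, 0), (-1, -1, 1, 0), (-1, 0, 1, 1), (-1, 0, 1, -1)}"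
  using assms unfolding A2_roots_def by (elim insertE emptyE; simp)

text \<open>Two roots differ by a root exactly when they enclose an angle of 60 degrees, which gives
  6 * 2 pairs. As changes of superbase they are the 6 permutations of \<open>v0, v1, v2\<close> with
  a common sign.\<close>

lemma A2_roots_differ_by_root:
  assumes "(a, c) \<in> A2_roots" "(b, d) \<in> A2_roots" "(a - b, c - d) \<in> A2_roots"
  shows "(a, b, c, d) \<in>
    {(1, 0, 0, 1), (1, 1, 0, -1), (-1, 0, 0, -1), (-1, -1, 0, 1), (0, 1, 1, 0), (0, -1, 1, 1),
     (0, -1, -1, 0), (0, 1, -1, -1), (1, 1, -1, 0), (1, 0, -1, -1), (-1, -1, 1, 0), (-1, 0, 1, 1)}"
  using assms unfolding A2_roots_def by (elim insertE emptyE; simp)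

lemma conorm_sum_inner:
  assumes "v0 = - v1 - v2"
  shows "v0 \<bullet> v0 = conorm v0 v1 + conorm v0 v2" "v1 \<bullet> v1 = conorm v0 v1 + conorm v1 v2"
    "v2 \<bullet> v2 = conorm v0 v2 + conorm v1 v2" "v1 \<bullet> v2 = - conorm v1 v2"
  by (simp_all add: assms conorm_def inner_add_left inner_add_right inner_diff_left inner_diff_right
      inner_commute[of v2 v1])

text \<open>Regrouping Selling's formula by conorms: the weight of each conorm is the squared length
  of a column of three coordinates of sum zero, or of the difference of the two columns.\<close>

lemma energy_combination:
  assumes "v0 = - v1 - v2" "w0 = - w1 - w2"
    and "w1 = a *\<^sub>R v1 + b *\<^sub>R v2" "w2 = c *\<^sub>R v1 + d *\<^sub>R v2"
  shows "energy w0 w1 w2 = conorm v0 v1 * (a\<^sup>2 + c\<^sup>2 + (a + c)\<^sup>2)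
    + conorm v0 v2 * (b\<^sup>2 + d\<^sup>2 + (b + d)\<^sup>2)
    + conorm v1 v2 * ((a - b)\<^sup>2 + (c - d)\<^sup>2 + ((a - b) + (c - d))\<^sup>2)"
proof -
  have w0: "w0 = (- a - c) *\<^sub>R v1 + (- b - d) *\<^sub>R v2"
    by (simp add: assms(2,3,4) algebra_simps)
  show ?thesis
    unfolding energy_def w0 assms(3,4) selling_inner[OF assms(1)]
    by (simp add: power2_eq_square algebra_simps)
qed

lemma energy_obtuse_superbase:
  assumes "obtuse_superbase \<Lambda> v0 v1 v2"
  shows "energy v0 v1 v2 = 2 * (conorm v0 v1 + conorm v0 v2 + conorm v1 v2)"
  using assms conorm_sum_inner[of v0 v1 v2]
  by (simp add: obtuse_superbase_def superbase_iff energy_def)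

text \<open>The superbase itself has weight 2 at every conorm, whence the subtracted 2 in each
  coefficient.\<close>

lemma obtuse_superbase_energy_excess:
  assumes "obtuse_superbase \<Lambda> v0 v1 v2" "superbase \<Lambda> w0 w1 w2"
    and w: "w1 = of_int a *\<^sub>R v1 + of_int b *\<^sub>R v2" "w2 = of_int c *\<^sub>R v1 + of_int d *\<^sub>R v2"
  shows "energy w0 w1 w2 - energy v0 v1 v2 =
      conorm v0 v1 * of_int (a\<^sup>2 + c\<^sup>2 + (a + c)\<^sup>2 - 2)
    + conorm v0 v2 * of_int (b\<^sup>2 + d\<^sup>2 + (b + d)\<^sup>2 - 2)
    + conorm v1 v2 * of_int ((a - b)\<^sup>2 + (c - d)\<^sup>2 + ((a - b) + (c - d))\<^sup>2 - 2)"
proof -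
  have 0: "v0 = - v1 - v2" "w0 = - w1 - w2"
    using assms by (simp_all add: obtuse_superbase_def superbase_iff)
  show ?thesis
    unfolding energy_obtuse_superbase[OF assms(1)] energy_combination[OF 0 w]
    by (simp add: algebra_simps)
qed

text \<open>Independent columns are nonzero and distinct, so both columns and their difference have
  squared length at least 2.\<close>

lemma energy_excess_nonneg:
  fixes a b c d :: int
  assumes "a * d - b * c \<noteq> 0"
  shows "0 \<le> a\<^sup>2 + c\<^sup>2 + (a + c)\<^sup>2 - 2" "0 \<le> b\<^sup>2 + d\<^sup>2 + (b + d)\<^sup>2 - 2"
    "0 \<le> (a - b)\<^sup>2 + (c - d)\<^sup>2 + ((a - b) + (c - d))\<^sup>2 - 2"
proof -
  have "a \<noteq> 0 \<or> c \<noteq> 0" "b \<noteq> 0 \<or> d \<noteq> 0" "a - b \<noteq> 0 \<or> c - d \<noteq> 0"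
    using assms by auto
  then show "0 \<le> a\<^sup>2 + c\<^sup>2 + (a + c)\<^sup>2 - 2" "0 \<le> b\<^sup>2 + d\<^sup>2 + (b + d)\<^sup>2 - 2"
    "0 \<le> (a - b)\<^sup>2 + (c - d)\<^sup>2 + ((a - b) + (c - d))\<^sup>2 - 2"
    using sum_zero_squares_ge_2[of a c] sum_zero_squares_ge_2[of b d]
      sum_zero_squares_ge_2[of "a - b" "c - d"] by linarith+
qed

lemma obtuse_superbase_energy_le:
  assumes "obtuse_superbase \<Lambda> v0 v1 v2" "superbase \<Lambda> w0 w1 w2"
  shows "energy v0 v1 v2 \<le> energy w0 w1 w2"
proof -
  obtain a b c d :: int where w: "w1 = of_int a *\<^sub>R v1 + of_int b *\<^sub>R v2"
    "w2 = of_int c *\<^sub>R v1 + of_int d *\<^sub>R v2" and D: "a * d - b * c \<noteq> 0"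
    using assms superbase_coordinates by (metis obtuse_superbase_def)
  have "0 \<le> energy w0 w1 w2 - energy v0 v1 v2"
    unfolding obtuse_superbase_energy_excess[OF assms w]
    using energy_excess_nonneg[OF D] assms(1)
    by (intro add_nonneg_nonneg mult_nonneg_nonneg)
      (simp_all only: obtuse_superbase_def of_int_0_le_iff)
  then show ?thesis
    by simp
qed

text \<open>Each of the two superbases has minimal energy, so the excess, a sum of nonnegative
  products, is zero. A positive conorm then forces its column to be a root; a zero conorm leaves its
  column free, hence the conditional conclusions.\<close>

lemma obtuse_superbases_coordinates:
  assumes "obtuse_superbase \<Lambda> v0 v1 v2" "obtuse_superbase \<Lambda> w0 w1 w2"
  obtains a b c d :: int where "w1 = of_int a *\<^sub>R v1 + of_int b *\<^sub>R v2"
    "w2 = of_int c *\<^sub>R v1 + of_int d *\<^sub>R v2" "a * d - b * c \<noteq> 0"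
    "conorm v0 v1 > 0 \<Longrightarrow> (a, c) \<in> A2_roots"
    "conorm v0 v2 > 0 \<Longrightarrow> (b, d) \<in> A2_roots"
    "conorm v1 v2 > 0 \<Longrightarrow>
      (a - b, c - d) \<in> A2_roots"
proof -
  have sb: "superbase \<Lambda> v0 v1 v2" "superbase \<Lambda> w0 w1 w2"
    using assms by (simp_all add: obtuse_superbase_def)
  obtain a b c d :: int where w: "w1 = of_int a *\<^sub>R v1 + of_int b *\<^sub>R v2"
    "w2 = of_int c *\<^sub>R v1 + of_int d *\<^sub>R v2" and D: "a * d - b * c \<noteq> 0"
    using superbase_coordinates[OF sb] by metis
  let ?A = "a\<^sup>2 + c\<^sup>2 + (a + c)\<^sup>2 - 2" and ?B = "b\<^sup>2 + d\<^sup>2 + (b + d)\<^sup>2 - 2"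
    and ?C = "(a - b)\<^sup>2 + (c - d)\<^sup>2 + ((a - b) + (c - d))\<^sup>2 - 2"
  have "energy w0 w1 w2 - energy v0 v1 v2 = 0"
    using obtuse_superbase_energy_le[OF assms(1) sb(2)] obtuse_superbase_energy_le[OF assms(2) sb(1)]
    by simp
  then have E: "conorm v0 v1 * of_int ?A + conorm v0 v2 * of_int ?B + conorm v1 v2 * of_int ?C = 0"
    unfolding obtuse_superbase_energy_excess[OF assms(1) sb(2) w] .
  have nn: "0 \<le> conorm v0 v1 * of_int ?A" "0 \<le> conorm v0 v2 * of_int ?B"
     "0 \<le> conorm v1 v2 * of_int ?C"
    using energy_excess_nonneg[OF D] assms(1)
    by (auto intro!: mult_nonneg_nonneg simp only: obtuse_superbase_def of_int_0_le_iff)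
  have *: "x = 0" if "0 < p" "p * of_int x = 0" for p :: real and x :: int
    using that by simp
  have "?A = 0" if "conorm v0 v1 > 0"
    by (rule *[OF that]) (use E nn in linarith)
  then have A: "conorm v0 v1 > 0 \<Longrightarrow> a\<^sup>2 + c\<^sup>2 + (a + c)\<^sup>2 = 2" by simp
  have "?B = 0" if "conorm v0 v2 > 0"
    by (rule *[OF that]) (use E nn in linarith)
  then have B: "conorm v0 v2 > 0 \<Longrightarrow> b\<^sup>2 + d\<^sup>2 + (b + d)\<^sup>2 = 2" by simp
  have "?C = 0" if "conorm v1 v2 > 0"
    by (rule *[OF that]) (use E nn in linarith)
  then have C: "conorm v1 v2 > 0 \<Longrightarrow> (a - b)\<^sup>2 + (c - d)\<^sup>2 + ((a - b) + (c - d))\<^sup>2 = 2" by simp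
  show ?thesis
    by (rule that[OF w D]) (rule sum_zero_squares_eq_2, erule A B C)+
qed

text \<open>The Gram determinant in symmetric form. With nonnegative conorms it shows that two of
  them cannot vanish together.\<close>

lemma det2_sq_conorm:
  assumes "superbase \<Lambda> v0 v1 v2"
  shows "(det2 v1 v2)\<^sup>2 =
    conorm v1 v2 * conorm v0 v1 + conorm v1 v2 * conorm v0 v2 + conorm v0 v1 * conorm v0 v2"
proof -
  have v0: "v0 = - v1 - v2"
    using assms by (simp add: superbase_iff)
  show ?thesis
    unfolding det2_sq conorm_sum_inner[OF v0] by (simp add: power2_eq_square algebra_simps)
qed

text \<open>Sorting puts the only conorm that may vanish at \<open>conorm v1 v2\<close>, so both
  coordinate columns are roots in any case. Multisets are compared because the labelling of the
  second superbase is arbitrary.\<close>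

lemma obtuse_superbases_conorms_eq:
  assumes v: "obtuse_superbase \<Lambda> v0 v1 v2" and w: "obtuse_superbase \<Lambda> w0 w1 w2"
    and sorted: "conorm v1 v2 \<le> conorm v0 v1" "conorm v0 v1 \<le> conorm v0 v2"
  shows "mset [conorm w1 w2, conorm w0 w1, conorm w0 w2]
    = mset [conorm v1 v2, conorm v0 v1, conorm v0 v2]"
proof -
  have v0: "v0 = - v1 - v2" and w0: "w0 = - w1 - w2" and sb: "superbase \<Lambda> v0 v1 v2"
    and nn: "conorm v1 v2 \<ge> 0" and "det2 v1 v2 \<noteq> 0"
    using v w by (simp_all add: obtuse_superbase_def superbase_iff)
  have "conorm v0 v1 \<noteq> 0"
  proof
    assume "conorm v0 v1 = 0"
    then have "(det2 v1 v2)\<^sup>2 = 0"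
      using det2_sq_conorm[OF sb] sorted nn by simp
    then show False
      using \<open>det2 v1 v2 \<noteq> 0\<close> by simp
  qed
  then have pos: "conorm v0 v1 > 0" "conorm v0 v2 > 0"
    using sorted nn by linarith+
  obtain a b c d :: int where w12: "w1 = of_int a *\<^sub>R v1 + of_int b *\<^sub>R v2"
      "w2 = of_int c *\<^sub>R v1 + of_int d *\<^sub>R v2"
    and D: "a * d - b * c \<noteq> 0"
    and ac: "(a, c) \<in> A2_roots"
    and bd: "(b, d) \<in> A2_roots"
    and eq: "conorm v1 v2 > 0 \<Longrightarrow>
      (a - b, c - d) \<in> A2_roots"
    using obtuse_superbases_coordinates[OF v w] pos by metis
  have w0': "w0 = of_int (- a - c) *\<^sub>R v1 + of_int (- b - d) *\<^sub>R v2"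
    by (simp add: w0 w12 algebra_simps)
  \<comment> \<open>With integral coefficients exposed, each listed change of superbase is checked
    by evaluation.\<close>
  have q: "conorm w1 w2 = - (of_int (a * c) * conorm v0 v1 + of_int (b * d) * conorm v0 v2
        + of_int ((a - b) * (c - d)) * conorm v1 v2)"
     "conorm w0 w1 = of_int ((a + c) * a) * conorm v0 v1 + of_int ((b + d) * b) * conorm v0 v2
        + of_int ((a + c - b - d) * (a - b)) * conorm v1 v2"
     "conorm w0 w2 = of_int ((a + c) * c) * conorm v0 v1 + of_int ((b + d) * d) * conorm v0 v2
        + of_int ((a + c - b - d) * (c - d)) * conorm v1 v2"
    unfolding conorm_def[of w1] conorm_def[of w0] unfolding w0' w12 selling_inner[OF v0]
    by (simp_all add: algebra_simps)
  show ?thesis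
  proof (cases "conorm v1 v2 > 0")
    case True
    then show ?thesis
      using A2_roots_differ_by_root[OF ac bd eq[OF True]] unfolding q by (elim insertE emptyE; simp add: add_mset_commute)
  next
    case False
    \<comment> \<open>The difference of the columns is unconstrained here, but its weight is zero,
      so all 24 independent pairs give the same conorms.\<close>
    then have "conorm v1 v2 = 0"
      using nn by simp
    then show ?thesis
      using A2_roots_independent[OF ac bd D] unfolding q by (elim insertE emptyE; simp add: add_mset_commute)
  qed
qed

text \<open>This gives the uniqueness that the \<open>THE\<close> in \<open>lattice_sign\<close>
  requires.\<close>

lemma obtuse_superbases_det2_eq:
  assumes v: "obtuse_superbase \<Lambda> v0 v1 v2" and w: "obtuse_superbase \<Lambda> w0 w1 w2"
    and v_less: "0 < conorm v1 v2" "conorm v1 v2 < conorm v0 v1" "conorm v0 v1 < conorm v0 v2"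
    and w_less: "w1 \<bullet> w1 < w2 \<bullet> w2" "w2 \<bullet> w2 < w0 \<bullet> w0"
  shows "det2 w1 w2 = det2 v1 v2"
proof -
  have v0: "v0 = - v1 - v2" and w0: "w0 = - w1 - w2"
    using v w by (simp_all add: obtuse_superbase_def superbase_iff)
  have pos: "0 < conorm v1 v2" "0 < conorm v0 v1" "0 < conorm v0 v2"
    using v_less by simp_all
  obtain a b c d :: int where w12: "w1 = of_int a *\<^sub>R v1 + of_int b *\<^sub>R v2"
      "w2 = of_int c *\<^sub>R v1 + of_int d *\<^sub>R v2"
    and ac: "(a, c) \<in> A2_roots"
    and bd: "(b, d) \<in> A2_roots"
    and eq: "(a - b, c - d) \<in> A2_roots"
    using obtuse_superbases_coordinates[OF v w] pos by metis
  have w0': "w0 = of_int (- a - c) *\<^sub>R v1 + of_int (- b - d) *\<^sub>R v2"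
    by (simp add: w0 w12 algebra_simps)
  \<comment> \<open>Of the twelve changes the order of the lengths admits only plus and minus the
    identity.\<close>
  have "a * d - b * c = 1"
    using A2_roots_differ_by_root[OF ac bd eq] v_less w_less
    unfolding w0' w12 selling_inner[OF v0] by (elim insertE emptyE; simp)
  then have "real_of_int a * real_of_int d - real_of_int b * real_of_int c = 1"
    by (metis of_int_1 of_int_diff of_int_mult)
  then show ?thesis
    by (simp add: w12 det2_combination)
qed

section \<open>Linear similarities\<close>

definition linear_similarity :: "real \<Rightarrow> (real^2 \<Rightarrow> real^2) \<Rightarrow> bool" where
  "linear_similarity s h \<longleftrightarrow> linear h \<and> s > 0 \<and> (\<forall>x. norm (h x) = s * norm x)"

lemma linear_similarity_inner:
  assumes "linear_similarity s h"
  shows "h x \<bullet> h y = s\<^sup>2 * (x \<bullet> y)"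
proof -
  have h: "linear h" "\<And>x. norm (h x) = s * norm x"
    using assms by (simp_all add: linear_similarity_def)
  have "h x \<bullet> h y = ((norm (h (x + y)))\<^sup>2 - (norm (h x))\<^sup>2 - (norm (h y))\<^sup>2) / 2"
    by (simp add: dot_norm linear_add[OF h(1)])
  also have "\<dots> = s\<^sup>2 * (x \<bullet> y)"
    unfolding h(2) dot_norm[of x y] by (simp add: power_mult_distrib field_simps)
  finally show ?thesis .
qed

lemma det2_linear:
  assumes "linear h"
  shows "det2 (h x) (h y) = det (matrix h) * det2 x y"
proof -
  have "h x = matrix h *v x" "h y = matrix h *v y"
    using matrix_vector_mul(2)[OF assms] by metis+
  then show ?thesis
    by (simp add: det2_def det_2 matrix_vector_mult_def sum_2 algebra_simps)
qed

lemma det_matrix_scaleR: "det (matrix (\<lambda>x. c *\<^sub>R h x) :: real^2^2) = c\<^sup>2 * det (matrix h)"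
  by (simp add: det_2 matrix_def power2_eq_square algebra_simps)

lemma linear_similarity_det_nonzero:
  assumes "linear_similarity s h"
  shows "det (matrix h) \<noteq> 0"
proof
  assume "det (matrix h) = 0"
  then have "det2 (h (vector [1, 0])) (h (vector [0, 1])) = 0"
    using assms by (simp add: det2_linear linear_similarity_def)
  moreover have "(det2 (h (vector [1, 0])) (h (vector [0, 1])))\<^sup>2 =
      (s\<^sup>2)\<^sup>2 * (det2 (vector [1, 0]) (vector [0, 1]))\<^sup>2"
    unfolding det2_sq linear_similarity_inner[OF assms] by (simp add: power2_eq_square algebra_simps)
  ultimately show False
    using assms by (simp add: linear_similarity_def det2_def vector_2)
qed

lemma linear_similarity_compose:
  assumes "linear_similarity s h" "linear_similarity t k"
  shows "linear_similarity (t * s) (k \<circ> h)" "det (matrix (k \<circ> h)) = det (matrix k) * det (matrix h)"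
  using assms by (auto simp: linear_similarity_def linear_compose matrix_compose det_mul)

lemma linear_similarity_inverse:
  assumes "linear_similarity s h"
  obtains k where "linear_similarity (1 / s) k" "\<And>x. k (h x) = x"
    "det (matrix k) * det (matrix h) = 1"
proof -
  have h: "linear h" "\<And>x. norm (h x) = s * norm x" "s > 0"
    using assms by (simp_all add: linear_similarity_def)
  have "inj h"
    unfolding linear_injective_0[OF h(1)] by (metis h(2,3) mult_eq_0_iff less_irrefl norm_eq_zero)
  then obtain k where k: "linear k" "\<And>x. k (h x) = x" "\<And>x. h (k x) = x"
    using linear_injective_isomorphism[OF h(1)] by blast
  have "norm (k x) = 1 / s * norm x" for x
    using h(2)[of "k x"] h(3) by (simp add: k(3))
  then have ls: "linear_similarity (1 / s) k"
    using k h by (simp add: linear_similarity_def)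
  have "k \<circ> h = id"
    using k by auto
  then have "det (matrix k) * det (matrix h) = 1"
    using linear_similarity_compose(2)[OF assms ls] by (simp add: matrix_id_mat_1)
  then show ?thesis
    using that ls k by blast
qed

lemma linear_similarity_image_superbase:
  assumes "linear_similarity s h" "superbase \<Lambda> v0 v1 v2"
  shows "superbase (h ` \<Lambda>) (h v0) (h v1) (h v2)"
proof -
  have h: "linear h"
    using assms by (simp add: linear_similarity_def)
  have "h ` int_combinations v1 v2 = int_combinations (h v1) (h v2)"
    by (force simp: int_combinations_def linear_add[OF h] linear_cmul[OF h] image_iff)
  then show ?thesis
    using assms(2) linear_similarity_det_nonzero[OF assms(1)]
    by (simp add: superbase_iff det2_linear[OF h] linear_diff[OF h] linear_neg[OF h])
qed

lemma linear_similarity_conorm: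
  "linear_similarity s h \<Longrightarrow> conorm (h v) (h w) = s\<^sup>2 * conorm v w"
  by (simp add: conorm_def linear_similarity_inner)

lemma linear_similarity_image_obtuse_superbase:
  assumes "linear_similarity s h" "obtuse_superbase \<Lambda> v0 v1 v2"
  shows "obtuse_superbase (h ` \<Lambda>) (h v0) (h v1) (h v2)"
  using assms linear_similarity_image_superbase
  by (auto simp: obtuse_superbase_def linear_similarity_conorm)

text \<open>The linear map sending one basis to the other scales all lengths by \<open>s\<close> as
  soon as it scales the Gram matrix by the square of \<open>s\<close>.\<close>

lemma linear_similarity_exists:
  assumes D: "det2 v1 v2 \<noteq> 0" and s: "s > 0"
    and eq: "w1 \<bullet> w1 = s\<^sup>2 * (v1 \<bullet> v1)" "w1 \<bullet> w2 = s\<^sup>2 * (v1 \<bullet> v2)" "w2 \<bullet> w2 = s\<^sup>2 * (v2 \<bullet> v2)"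
  obtains h where "linear_similarity s h" "h v1 = w1" "h v2 = w2"
proof -
  \<comment> \<open>\<open>a x\<close> and \<open>b x\<close> are the coordinates of
    \<open>x\<close> in the basis \<open>v1, v2\<close>, by Cramer's rule.\<close>
  define a where "a x = det2 x v2 / det2 v1 v2" for x
  define b where "b x = det2 v1 x / det2 v1 v2" for x
  define h where "h x = a x *\<^sub>R w1 + b x *\<^sub>R w2" for x
  have x: "x = a x *\<^sub>R v1 + b x *\<^sub>R v2" for x
  proof -
    have "x = (1 / det2 v1 v2) *\<^sub>R (det2 v1 v2 *\<^sub>R x)"
      using D by simp
    also have "\<dots> = a x *\<^sub>R v1 + b x *\<^sub>R v2"
      by (subst cramer_2) (simp add: a_def b_def scaleR_add_right)
    finally show ?thesis .
  qed
  have lin: "a (x + y) = a x + a y" "b (x + y) = b x + b y" "a (c *\<^sub>R x) = c * a x" "b (c *\<^sub>R x) = c * b x"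
    for x y c
    by (simp_all add: a_def b_def det2_def algebra_simps add_divide_distrib diff_divide_distrib)
  have "linear h"
    by (rule linearI) (simp_all add: h_def lin algebra_simps)
  moreover have "norm (h x) = s * norm x" for x
  proof -
    have "h x \<bullet> h x = (a x)\<^sup>2 * (w1 \<bullet> w1) + 2 * a x * b x * (w1 \<bullet> w2) + (b x)\<^sup>2 * (w2 \<bullet> w2)"
      by (simp add: h_def inner_add_left inner_add_right inner_commute[of w2 w1] power2_eq_square algebra_simps)
    moreover have "x \<bullet> x = (a x)\<^sup>2 * (v1 \<bullet> v1) + 2 * a x * b x * (v1 \<bullet> v2) + (b x)\<^sup>2 * (v2 \<bullet> v2)"
      by (subst (1 2) x) (simp add: inner_add_left inner_add_right inner_commute[of v2 v1] power2_eq_square algebra_simps)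
    ultimately have "h x \<bullet> h x = s\<^sup>2 * (x \<bullet> x)"
      unfolding eq by (simp add: algebra_simps)
    then have "(norm (h x))\<^sup>2 = (s * norm x)\<^sup>2"
      by (simp add: power2_norm_eq_inner power_mult_distrib)
    then show ?thesis
      using s by (simp add: power2_eq_iff_nonneg)
  qed
  ultimately have "linear_similarity s h"
    using s by (simp add: linear_similarity_def)
  moreover have "h v1 = w1" "h v2 = w2"
    using D by (simp_all add: h_def a_def b_def) (simp_all add: det2_def)
  ultimately show ?thesis
    using that by blast
qed

text \<open>The three conorms carry the same information as the Gram matrix of
  \<open>v1, v2\<close>, so proportional conorms suffice to match the superbases, and with them the
  lattices.\<close>

lemma superbase_linear_similarity:
  assumes v: "superbase \<Lambda> v0 v1 v2" and w: "superbase \<Lambda>' w0 w1 w2" and s: "s > 0"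
    and eq: "conorm w1 w2 = s\<^sup>2 * conorm v1 v2" "conorm w0 w1 = s\<^sup>2 * conorm v0 v1"
      "conorm w0 w2 = s\<^sup>2 * conorm v0 v2"
  obtains h where "linear_similarity s h" "h ` \<Lambda> = \<Lambda>'" "h v1 = w1" "h v2 = w2"
proof -
  have v0: "v0 = - v1 - v2" and w0: "w0 = - w1 - w2" and D: "det2 v1 v2 \<noteq> 0"
    using v w by (simp_all add: superbase_iff)
  have "w1 \<bullet> w1 = s\<^sup>2 * (v1 \<bullet> v1)" "w1 \<bullet> w2 = s\<^sup>2 * (v1 \<bullet> v2)" "w2 \<bullet> w2 = s\<^sup>2 * (v2 \<bullet> v2)"
    unfolding conorm_sum_inner[OF v0] conorm_sum_inner[OF w0] eq by (simp_all add: algebra_simps)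
  then obtain h where h: "linear_similarity s h" "h v1 = w1" "h v2 = w2"
    using linear_similarity_exists[OF D s] by metis
  have "h ` \<Lambda> = \<Lambda>'"
    using linear_similarity_image_superbase[OF h(1) v] w by (simp add: superbase_iff h)
  with h show ?thesis
    using that by blast
qed

section \<open>From affine to linear similarities\<close>

lemma planar_lattice_translate:
  assumes "planar_lattice \<Lambda>" "t \<in> \<Lambda>"
  shows "(\<lambda>x. x - t) ` \<Lambda> = \<Lambda>" "0 \<in> \<Lambda>"
proof -
  obtain v w where \<Lambda>: "\<Lambda> = int_combinations v w"
    using assms(1) by (auto simp: planar_lattice_def)
  have d: "x - t \<in> \<Lambda>" "x + t \<in> \<Lambda>" if "x \<in> \<Lambda>" for x
    using int_combinations_closed[of x v w t 1 "-1"] int_combinations_closed[of x v w t 1 1]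
      that assms(2) by (simp_all add: \<Lambda>)
  show "(\<lambda>x. x - t) ` \<Lambda> = \<Lambda>"
    using d by (force simp: image_iff)
  show "0 \<in> \<Lambda>"
    using d(1)[OF assms(2)] by simp
qed

text \<open>The translation part \<open>t\<close> is the image of 0 under \<open>f\<close>, hence a
  vector of the target lattice, and subtracting it permutes that lattice.\<close>

lemma image_affine_lattice:
  assumes L: "planar_lattice \<Lambda>" "planar_lattice \<Lambda>'" and f: "\<And>x. f x = h x + t" and "h 0 = 0" "f ` \<Lambda> = \<Lambda>'"
  shows "h ` \<Lambda> = \<Lambda>'"
proof -
  have "\<exists>x. x \<in> \<Lambda>"
    using L(1) int_combinations_basis by (auto simp: planar_lattice_def)
  then have "0 \<in> \<Lambda>"
    using planar_lattice_translate(2)[OF L(1)] by blast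
  then have "t \<in> \<Lambda>'"
    using assms by (metis add_0 imageI)
  have "h ` \<Lambda> = (\<lambda>x. x - t) ` (f ` \<Lambda>)"
    by (simp add: image_image f)
  then show ?thesis
    using planar_lattice_translate(1)[OF L(2) \<open>t \<in> \<Lambda>'\<close>] assms by simp
qed

lemma isometry_linear_part:
  assumes "isometry g" "s > 0"
  shows "linear_similarity s (\<lambda>x. s *\<^sub>R (g x - g 0))"
    "(g \<circ> (\<lambda>v. s *\<^sub>R v)) x = s *\<^sub>R (g x - g 0) + g 0"
    "orthogonal_transformation (\<lambda>x. g x - g 0)"
proof -
  show o: "orthogonal_transformation (\<lambda>x. g x - g 0)"
    using assms by (simp add: orthogonal_transformation_isometry isometry_def dist_norm)
  then have l: "linear (\<lambda>x. g x - g 0)"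
    by (rule orthogonal_transformation_linear)
  show "(g \<circ> (\<lambda>v. s *\<^sub>R v)) x = s *\<^sub>R (g x - g 0) + g 0"
    using linear_cmul[OF l, of s x] by (simp add: algebra_simps)
  show "linear_similarity s (\<lambda>x. s *\<^sub>R (g x - g 0))"
    using o assms(2) linear_compose_scale_right[OF l]
    by (simp add: linear_similarity_def orthogonal_transformation)
qed

lemma linear_similarity_isometry:
  assumes "linear_similarity s h"
  shows "isometry (\<lambda>x. (1 / s) *\<^sub>R h x)" "h = (\<lambda>x. (1 / s) *\<^sub>R h x) \<circ> (\<lambda>v. s *\<^sub>R v)"
    "orthogonal_transformation (\<lambda>x. (1 / s) *\<^sub>R h x)" "s > 0" "h 0 = 0"
proof -
  have h: "linear h" "\<And>x. norm (h x) = s * norm x" and s: "s > 0"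
    using assms by (simp_all add: linear_similarity_def)
  show o: "orthogonal_transformation (\<lambda>x. (1 / s) *\<^sub>R h x)"
    using h s linear_compose_scale_right[OF h(1)] by (simp add: orthogonal_transformation)
  then show "isometry (\<lambda>x. (1 / s) *\<^sub>R h x)"
    by (simp add: orthogonal_transformation_isometry isometry_def)
  show "h = (\<lambda>x. (1 / s) *\<^sub>R h x) \<circ> (\<lambda>v. s *\<^sub>R v)"
    using s by (auto simp: linear_cmul[OF h(1)])
  show "s > 0" "h 0 = 0"
    using s linear_0[OF h(1)] by simp_all
qed

lemma similar_lattices_iff:
  assumes L: "planar_lattice \<Lambda>" "planar_lattice \<Lambda>'"
  shows "similar_lattices \<Lambda> \<Lambda>' \<longleftrightarrow> (\<exists>s h. linear_similarity s h \<and> h ` \<Lambda> = \<Lambda>')"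
proof
  assume "similar_lattices \<Lambda> \<Lambda>'"
  then obtain g s where g: "isometry g" "s > 0" "(g \<circ> (\<lambda>v. s *\<^sub>R v)) ` \<Lambda> = \<Lambda>'"
    by (auto simp: similar_lattices_def similarity_def)
  have "(\<lambda>x. s *\<^sub>R (g x - g 0)) ` \<Lambda> = \<Lambda>'"
    by (rule image_affine_lattice[OF L isometry_linear_part(2)[OF g(1,2)] _ g(3)]) simp
  then show "\<exists>s h. linear_similarity s h \<and> h ` \<Lambda> = \<Lambda>'"
    using isometry_linear_part(1)[OF g(1,2)] by blast
next
  assume "\<exists>s h. linear_similarity s h \<and> h ` \<Lambda> = \<Lambda>'"
  then obtain s h where h: "linear_similarity s h" "h ` \<Lambda> = \<Lambda>'"
    by blast
  have "similarity h"
    unfolding similarity_def by (intro exI conjI) (rule linear_similarity_isometry[OF h(1)])+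
  then show "similar_lattices \<Lambda> \<Lambda>'"
    using h(2) by (auto simp: similar_lattices_def)
qed

lemma oriented_similar_lattices_iff:
  assumes L: "planar_lattice \<Lambda>" "planar_lattice \<Lambda>'"
  shows "oriented_similar_lattices \<Lambda> \<Lambda>' \<longleftrightarrow>
    (\<exists>s h. linear_similarity s h \<and> det (matrix h) > 0 \<and> h ` \<Lambda> = \<Lambda>')"
proof
  assume "oriented_similar_lattices \<Lambda> \<Lambda>'"
  then obtain g s where g: "isometry g" "s > 0" "(g \<circ> (\<lambda>v. s *\<^sub>R v)) ` \<Lambda> = \<Lambda>'"
    and det: "det (matrix (\<lambda>x. g x - g 0)) = 1"
    by (auto simp: oriented_similar_lattices_def orientation_preserving_similarity_def
        orientation_preserving_isometry_def rotation_matrix_def)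
  have "det (matrix (\<lambda>x. s *\<^sub>R (g x - g 0))) > 0"
    unfolding det_matrix_scaleR[of s "\<lambda>x. g x - g 0"] det using g(2) by simp
  moreover have "(\<lambda>x. s *\<^sub>R (g x - g 0)) ` \<Lambda> = \<Lambda>'"
    by (rule image_affine_lattice[OF L isometry_linear_part(2)[OF g(1,2)] _ g(3)]) simp
  ultimately show "\<exists>s h. linear_similarity s h \<and> det (matrix h) > 0 \<and> h ` \<Lambda> = \<Lambda>'"
    using isometry_linear_part(1)[OF g(1,2)] by blast
next
  assume "\<exists>s h. linear_similarity s h \<and> det (matrix h) > 0 \<and> h ` \<Lambda> = \<Lambda>'"
  then obtain s h where h: "linear_similarity s h" "det (matrix h) > 0" "h ` \<Lambda> = \<Lambda>'"
    by blast
  define g where "g x = (1 / s) *\<^sub>R h x" for x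
  note hs = linear_similarity_isometry[OF h(1), folded g_def]
  have g0: "(\<lambda>x. g x - g 0) = g"
    by (simp add: fun_eq_iff g_def hs(5))
  have "det (matrix g) = (1 / s)\<^sup>2 * det (matrix h)"
    using det_matrix_scaleR[of "1 / s" h] by (simp add: g_def[abs_def])
  then have "det (matrix g) > 0"
    using h(2) hs(4) by simp
  then have "det (matrix g) = 1"
    using orthogonal_transformation_det[OF hs(3)] by simp
  then have "orientation_preserving_isometry g"
    using hs(1,3) by (simp add: orientation_preserving_isometry_def g0 rotation_matrix_def orthogonal_transformation_matrix)
  then have "orientation_preserving_similarity h"
    unfolding orientation_preserving_similarity_def using hs(2,4) by blast
  then show "oriented_similar_lattices \<Lambda> \<Lambda>'"
    using h(3) by (auto simp: oriented_similar_lattices_def)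
qed

section \<open>Reflections as the orientation-reversing linear isometries\<close>

lemma line_reflection_linear_similarity:
  assumes "n \<noteq> 0"
  shows "linear_similarity 1 (line_reflection 0 n)" "det (matrix (line_reflection 0 n)) = -1"
proof -
  have n: "n \<bullet> n \<noteq> 0"
    using assms by simp
  have "linear (line_reflection 0 n)"
    by (rule linearI) (simp_all add: line_reflection_def inner_add_left algebra_simps add_divide_distrib)
  moreover have "norm (line_reflection 0 n x) = norm x" for x
  proof -
    have "line_reflection 0 n x \<bullet> line_reflection 0 n x = x \<bullet> x"
      using n by (simp add: line_reflection_def inner_diff_left inner_diff_right inner_commute[of n x] field_simps)
    then show ?thesis
      by (simp add: norm_eq_sqrt_inner)
  qed
  ultimately show "linear_similarity 1 (line_reflection 0 n)"
    by (simp add: linear_similarity_def)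
  show "det (matrix (line_reflection 0 n)) = -1"
  proof -
    \<comment> \<open>Naming the reciprocal keeps the determinant polynomial; that \<open>k\<close>
      times the squared length of \<open>n\<close> is 1 enters only at the end.\<close>
    define k where "k = 1 / (n \<bullet> n)"
    have "line_reflection 0 n x = x - (2 * k * (x \<bullet> n)) *\<^sub>R n" for x
      by (simp add: line_reflection_def k_def)
    then have "det (matrix (line_reflection 0 n)) =
        (1 - 2 * k * (n $ 1 * n $ 1)) * (1 - 2 * k * (n $ 2 * n $ 2)) - (2 * k * (n $ 1 * n $ 2))\<^sup>2"
      by (simp add: det_2 matrix_def inner_real2 axis_def power2_eq_square mult.assoc)
    also have "\<dots> = 1 - 2 * (k * (n \<bullet> n))"
      unfolding inner_real2 by algebra
    finally show ?thesis
      using n by (simp add: k_def)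
  qed
qed

text \<open>An orthogonal matrix of determinant -1 has rows (c, s) and (s, -c) with c^2 + s^2 = 1.
  It exchanges the first unit vector with its image, so their difference is normal to the mirror
  unless it vanishes.\<close>

lemma reversing_linear_isometry_is_reflection:
  assumes "linear_similarity 1 h" "det (matrix h) < 0"
  obtains n where "n \<noteq> 0" "h = line_reflection 0 n"
proof -
  have lin: "linear h"
    using assms by (simp add: linear_similarity_def)
  have o: "orthogonal_transformation h"
    using linear_similarity_isometry(3)[OF assms(1)] by simp
  define e1 e2 :: "real^2" where "e1 = vector [1, 0]" and "e2 = vector [0, 1]"
  have e: "e1 $ 1 = 1" "e1 $ 2 = 0" "e2 $ 1 = 0" "e2 $ 2 = 1"
    by (simp_all add: e1_def e2_def vector_2)
  have hx: "h x = x $ 1 *\<^sub>R h e1 + x $ 2 *\<^sub>R h e2" for x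
  proof -
    have "x = x $ 1 *\<^sub>R e1 + x $ 2 *\<^sub>R e2"
      by (simp add: vec_eq_iff_2 e)
    then show ?thesis
      by (metis linear_add[OF lin] linear_cmul[OF lin])
  qed
  have "det (matrix h) = -1"
    using orthogonal_transformation_det[OF o] assms(2) by linarith
  then have D: "det2 (h e1) (h e2) = -1"
    using det2_linear[OF lin, of e1 e2] by (simp add: det2_def[of e1] e)
  have i: "h e1 \<bullet> h e1 = 1" "h e1 \<bullet> h e2 = 0" "h e2 \<bullet> h e2 = 1"
    using linear_similarity_inner[OF assms(1)] by (simp_all add: inner_real2 e)
  define c s where "c = h e1 $ 1" and "s = h e1 $ 2"
  have cs: "c * c + s * s = 1"
    using i(1) by (simp add: inner_real2 c_def s_def)
  have 1: "c * h e2 $ 1 + s * h e2 $ 2 = 0" "c * h e2 $ 2 - s * h e2 $ 1 = -1"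
    using i(2) D by (simp_all add: inner_real2 c_def s_def det2_def)
  have "(c * c + s * s) * h e2 $ 1 = s" "(c * c + s * s) * h e2 $ 2 = - c"
    using 1 by algebra+
  then have h2: "h e2 $ 1 = s" "h e2 $ 2 = - c"
    by (simp_all add: cs)
  have h: "h x $ 1 = c * x $ 1 + s * x $ 2" "h x $ 2 = s * x $ 1 - c * x $ 2" for x
    by (subst hx, simp add: h2 c_def s_def)+
  show ?thesis
  proof (cases "c = 1")
    case True
    then have "s = 0"
      using cs by simp
    \<comment> \<open>Here \<open>h\<close> fixes \<open>e1\<close>, so the mirror is the first
      axis.\<close>
    then have "h = line_reflection 0 e2"
      using True by (auto simp: fun_eq_iff vec_eq_iff_2 h line_reflection_def inner_real2 e)
    moreover have "e2 \<noteq> 0"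
      using e(4) by auto
    ultimately show ?thesis
      using that by blast
  next
    case False
    \<comment> \<open>This is \<open>e1 - h e1\<close>, nonzero because \<open>c\<close> differs
      from 1.\<close>
    define n :: "real^2" where "n = vector [1 - c, - s]"
    have n: "n $ 1 = 1 - c" "n $ 2 = - s"
      by (simp_all add: n_def vector_2)
    have nn: "n \<bullet> n = 2 * (1 - c)"
      using cs by (simp add: inner_real2 n algebra_simps)
    have ss: "s * s = (1 - c) * (1 + c)"
      using cs by (simp add: algebra_simps)
    have "h x = line_reflection 0 n x" for x
    proof -
      have r: "2 * (x \<bullet> n) / (n \<bullet> n) = x $ 1 - s * x $ 2 / (1 - c)"
        using False unfolding nn unfolding inner_real2 n by (simp add: field_simps)
      have "(x $ 1 - s * x $ 2 / (1 - c)) * (1 - c) = x $ 1 * (1 - c) - s * x $ 2"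
        using False by (simp add: field_simps)
      moreover have "(x $ 1 - s * x $ 2 / (1 - c)) * (- s) = - s * x $ 1 + x $ 2 * (1 + c)"
      proof -
        have "s * x $ 2 / (1 - c) * s = x $ 2 * (s * s) / (1 - c)"
          by simp
        also have "\<dots> = x $ 2 * (1 + c)"
          unfolding ss using False by simp
        finally show ?thesis
          by (simp add: algebra_simps)
      qed
      ultimately show ?thesis
        unfolding line_reflection_def diff_0_right r
        by (simp add: vec_eq_iff_2 h n algebra_simps)
    qed
    then have "h = line_reflection 0 n"
      by auto
    moreover have "n \<noteq> 0"
      using False n(1) by auto
    ultimately show ?thesis
      using that by blast
  qed
qed

text \<open>A mirror off the origin contributes only a translation, which the lattice absorbs. In
  this form symmetries can be composed and conjugated.\<close>

lemma mirror_symmetric_iff: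
  assumes "planar_lattice \<Lambda>"
  shows "mirror_symmetric \<Lambda> \<longleftrightarrow> (\<exists>h. linear_similarity 1 h \<and> det (matrix h) < 0 \<and> h ` \<Lambda> = \<Lambda>)"
proof
  assume "mirror_symmetric \<Lambda>"
  then obtain p n where n: "n \<noteq> 0" "line_reflection p n ` \<Lambda> = \<Lambda>"
    by (auto simp: mirror_symmetric_def)
  have "line_reflection p n x = line_reflection 0 n x + (2 * (p \<bullet> n) / (n \<bullet> n)) *\<^sub>R n" for x
    by (simp add: line_reflection_def inner_diff_left algebra_simps diff_divide_distrib)
  moreover have "line_reflection 0 n 0 = 0"
    by (simp add: line_reflection_def)
  ultimately have "line_reflection 0 n ` \<Lambda> = \<Lambda>"
    using image_affine_lattice[OF assms assms] n(2) by blast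
  then show "\<exists>h. linear_similarity 1 h \<and> det (matrix h) < 0 \<and> h ` \<Lambda> = \<Lambda>"
    using line_reflection_linear_similarity[OF n(1)] by (intro exI[of _ "line_reflection 0 n"]) simp
next
  assume "\<exists>h. linear_similarity 1 h \<and> det (matrix h) < 0 \<and> h ` \<Lambda> = \<Lambda>"
  then show "mirror_symmetric \<Lambda>"
    unfolding mirror_symmetric_def using reversing_linear_isometry_is_reflection by metis
qed

section \<open>The invariants of a lattice\<close>

text \<open>This labelling also orders the lengths, with \<open>v1\<close> shortest and
  \<open>v0\<close> longest, as the definition of the sign demands.\<close>

definition sorted_superbase :: "(real^2) set \<Rightarrow> real^2 \<Rightarrow> real^2 \<Rightarrow> real^2 \<Rightarrow> bool" where
  "sorted_superbase \<Lambda> v0 v1 v2 \<longleftrightarrow> obtuse_superbase \<Lambda> v0 v1 v2 \<and>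
     conorm v1 v2 \<le> conorm v0 v1 \<and> conorm v0 v1 \<le> conorm v0 v2"

lemma sorted_superbase_exists:
  assumes "planar_lattice \<Lambda>"
  obtains v0 v1 v2 where "sorted_superbase \<Lambda> v0 v1 v2"
proof -
  obtain a b c where o: "obtuse_superbase \<Lambda> a b c"
    using obtuse_superbase_exists[OF assms] .
  note o2 = obtuse_superbase_swap01[OF o]
  note o3 = obtuse_superbase_swap12[OF o2]
  note all = o o2 o3 obtuse_superbase_swap12[OF o] obtuse_superbase_swap01[OF o3]
    obtuse_superbase_swap12[OF obtuse_superbase_swap01[OF o3]]
  show ?thesis
    using that[of a b c] that[of b a c] that[of b c a] that[of a c b] that[of c b a] that[of c a b] all
    unfolding sorted_superbase_def conorm_commute[of b a] conorm_commute[of c a] conorm_commute[of c b]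
    by linarith
qed

text \<open>Replaces the \<open>THE\<close> by a value: all obtuse superbases share the multiset of
  conorms, and sorting the roots depends only on that multiset.\<close>

lemma root_invariant_sorted_superbase:
  assumes "sorted_superbase \<Lambda> v0 v1 v2"
  shows "root_invariant \<Lambda> = (sqrt (conorm v1 v2), sqrt (conorm v0 v1), sqrt (conorm v0 v2))"
proof -
  have v: "obtuse_superbase \<Lambda> v0 v1 v2" "conorm v1 v2 \<le> conorm v0 v1" "conorm v0 v1 \<le> conorm v0 v2"
    using assms by (simp_all add: sorted_superbase_def)
  have sort_v: "sort [root_product v1 v2, root_product v0 v1, root_product v0 v2] =
      [sqrt (conorm v1 v2), sqrt (conorm v0 v1), sqrt (conorm v0 v2)]"
    using v by (simp add: root_product_def)
  have sort_w: "sort [root_product w1 w2, root_product w0 w1, root_product w0 w2] =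
      [sqrt (conorm v1 v2), sqrt (conorm v0 v1), sqrt (conorm v0 v2)]"
    if "obtuse_superbase \<Lambda> w0 w1 w2" for w0 w1 w2
  proof -
    have "mset (map sqrt [conorm w1 w2, conorm w0 w1, conorm w0 w2]) =
        mset (map sqrt [conorm v1 v2, conorm v0 v1, conorm v0 v2])"
      unfolding mset_map obtuse_superbases_conorms_eq[OF v(1) that v(2,3)] ..
    then have "sort (map sqrt [conorm w1 w2, conorm w0 w1, conorm w0 w2]) =
        sort (map sqrt [conorm v1 v2, conorm v0 v1, conorm v0 v2])"
      by (metis sorted_list_of_multiset_mset)
    then show ?thesis
      using sort_v by (simp only: root_product_def list.map)
  qed
  show ?thesis
    unfolding root_invariant_def
  proof (rule the_equality)
    show "case (sqrt (conorm v1 v2), sqrt (conorm v0 v1), sqrt (conorm v0 v2)) of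
        (r12, r01, r02) \<Rightarrow> \<exists>v0 v1 v2. obtuse_superbase \<Lambda> v0 v1 v2 \<and>
          [r12, r01, r02] = sort [root_product v1 v2, root_product v0 v1, root_product v0 v2]"
      unfolding prod.case using v(1) sort_v by metis
  next
    fix r
    assume "case r of (r12, r01, r02) \<Rightarrow> \<exists>v0 v1 v2. obtuse_superbase \<Lambda> v0 v1 v2 \<and>
          [r12, r01, r02] = sort [root_product v1 v2, root_product v0 v1, root_product v0 v2]"
    then obtain r12 r01 r02 w0 w1 w2 where r: "r = (r12, r01, r02)" and
      w: "obtuse_superbase \<Lambda> w0 w1 w2"
         "[r12, r01, r02] = sort [root_product w1 w2, root_product w0 w1, root_product w0 w2]"
      by (cases r) (simp only: prod.case, metis)
    show "r = (sqrt (conorm v1 v2), sqrt (conorm v0 v1), sqrt (conorm v0 v2))"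
      using w(2) unfolding sort_w[OF w(1)] r by simp
  qed
qed

lemma sorted_superbase_linear_similarity:
  assumes "linear_similarity s h" "sorted_superbase \<Lambda> v0 v1 v2"
  shows "sorted_superbase (h ` \<Lambda>) (h v0) (h v1) (h v2)"
  using assms linear_similarity_image_obtuse_superbase[OF assms(1)]
  by (auto simp: sorted_superbase_def linear_similarity_conorm mult_left_mono)

lemma projected_invariant_linear_similarity:
  assumes "planar_lattice \<Lambda>" "linear_similarity s h"
  shows "projected_invariant (h ` \<Lambda>) = projected_invariant \<Lambda>"
proof -
  have s: "s > 0"
    using assms by (simp add: linear_similarity_def)
  obtain v0 v1 v2 where v: "sorted_superbase \<Lambda> v0 v1 v2"
    using sorted_superbase_exists[OF assms(1)] .
  have r: "sqrt (conorm (h v) (h w)) = s * sqrt (conorm v w)" for v w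
    using s by (simp add: linear_similarity_conorm[OF assms(2)] real_sqrt_mult)
  have q: "s * x / (s * x' + s * y' + s * z') = x / (x' + y' + z')" for x x' y' z'
    using s by (simp flip: distrib_left)
  show ?thesis
    unfolding projected_invariant_def root_invariant_sorted_superbase[OF v]
      root_invariant_sorted_superbase[OF sorted_superbase_linear_similarity[OF assms(2) v]] r
    unfolding prod.case Let_def q ..
qed

text \<open>The normalising denominator. A zero sum would make all conorms vanish, and with them the
  determinant.\<close>

lemma sorted_superbase_sum_pos:
  assumes "sorted_superbase \<Lambda> v0 v1 v2"
  shows "sqrt (conorm v1 v2) + sqrt (conorm v0 v1) + sqrt (conorm v0 v2) > 0"
proof (rule ccontr)
  assume n: "\<not> ?thesis"
  have sb: "superbase \<Lambda> v0 v1 v2" and nn: "0 \<le> conorm v1 v2" "0 \<le> conorm v0 v1" "0 \<le> conorm v0 v2"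
    using assms by (simp_all add: sorted_superbase_def obtuse_superbase_def)
  have "sqrt (conorm v1 v2) = 0" "sqrt (conorm v0 v1) = 0" "sqrt (conorm v0 v2) = 0"
    using n nn[THEN real_sqrt_ge_zero] by linarith+
  then have "det2 v1 v2 = 0"
    using det2_sq_conorm[OF sb] by simp
  then show False
    using sb by (simp add: superbase_iff)
qed

text \<open>The normalised root products have sum 1; the invariant adds the smallest of them and the
  difference of the other two, so all three are determined. The factor \<open>s\<close> is the ratio
  of the two unnormalised sums.\<close>

lemma projected_invariant_eq_conorms:
  assumes v: "sorted_superbase \<Lambda> v0 v1 v2" and w: "sorted_superbase \<Lambda>' w0 w1 w2"
    and eq: "projected_invariant \<Lambda> = projected_invariant \<Lambda>'"
  obtains s where "s > 0" "conorm w1 w2 = s\<^sup>2 * conorm v1 v2" "conorm w0 w1 = s\<^sup>2 * conorm v0 v1"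
    "conorm w0 w2 = s\<^sup>2 * conorm v0 v2"
proof -
  define \<sigma> \<tau> where "\<sigma> = sqrt (conorm v1 v2) + sqrt (conorm v0 v1) + sqrt (conorm v0 v2)"
    and "\<tau> = sqrt (conorm w1 w2) + sqrt (conorm w0 w1) + sqrt (conorm w0 w2)"
  have pos: "\<sigma> > 0" "\<tau> > 0"
    using sorted_superbase_sum_pos v w by (simp_all add: \<sigma>_def \<tau>_def)
  have 12: "sqrt (conorm v1 v2) / \<sigma> = sqrt (conorm w1 w2) / \<tau>"
    and d: "sqrt (conorm v0 v2) / \<sigma> - sqrt (conorm v0 v1) / \<sigma> =
       sqrt (conorm w0 w2) / \<tau> - sqrt (conorm w0 w1) / \<tau>"
    using eq by (simp_all add: projected_invariant_def root_invariant_sorted_superbase[OF v]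
        root_invariant_sorted_superbase[OF w] Let_def \<sigma>_def \<tau>_def)
  have "sqrt (conorm v1 v2) / \<sigma> + sqrt (conorm v0 v1) / \<sigma> + sqrt (conorm v0 v2) / \<sigma> = 1"
    "sqrt (conorm w1 w2) / \<tau> + sqrt (conorm w0 w1) / \<tau> + sqrt (conorm w0 w2) / \<tau> = 1"
    using pos by (simp_all add: \<sigma>_def \<tau>_def flip: add_divide_distrib)
  then have r: "sqrt (conorm v0 v1) / \<sigma> = sqrt (conorm w0 w1) / \<tau>"
    "sqrt (conorm v0 v2) / \<sigma> = sqrt (conorm w0 w2) / \<tau>"
    using 12 d by linarith+
  have sq: "q = (\<tau> / \<sigma>)\<^sup>2 * p" if "sqrt p / \<sigma> = sqrt q / \<tau>" "0 \<le> p" "0 \<le> q" for p q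
  proof -
    have "sqrt q = \<tau> / \<sigma> * sqrt p"
      using that(1) pos by (simp add: field_simps)
    then have "(sqrt q)\<^sup>2 = (\<tau> / \<sigma>)\<^sup>2 * (sqrt p)\<^sup>2"
      by (simp only: power_mult_distrib)
    then show ?thesis
      using that by simp
  qed
  show ?thesis
  proof (rule that)
    show "\<tau> / \<sigma> > 0"
      using pos by simp
  qed (use sq 12 r v w in \<open>auto simp only: sorted_superbase_def obtuse_superbase_def\<close>)
qed

lemma projected_invariant_eq_imp_linear_similarity:
  assumes v: "sorted_superbase \<Lambda> v0 v1 v2" and w: "sorted_superbase \<Lambda>' w0 w1 w2"
    and eq: "projected_invariant \<Lambda> = projected_invariant \<Lambda>'"
  obtains s h where "linear_similarity s h" "h ` \<Lambda> = \<Lambda>'" "h v1 = w1" "h v2 = w2"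
proof -
  have "superbase \<Lambda> v0 v1 v2" "superbase \<Lambda>' w0 w1 w2"
    using v w by (simp_all add: sorted_superbase_def obtuse_superbase_def)
  then show ?thesis
    using projected_invariant_eq_conorms[OF v w eq] superbase_linear_similarity that by metis
qed

section \<open>Mirror symmetry and the sign\<close>

lemma superbase_planar_lattice: "superbase \<Lambda> v0 v1 v2 \<Longrightarrow> planar_lattice \<Lambda>"
  by (auto simp: superbase_def planar_lattice_def)

text \<open>The linear map matching two superbases of one lattice with equal conorms is an isometry
  of that lattice, and its determinant is the ratio of the two values of
  \<open>det2\<close>.\<close>

lemma superbase_reversing_symmetry_imp_mirror_symmetric:
  assumes v: "superbase \<Lambda> v0 v1 v2" and w: "superbase \<Lambda> w0 w1 w2"
    and eq: "conorm w1 w2 = conorm v1 v2" "conorm w0 w1 = conorm v0 v1" "conorm w0 w2 = conorm v0 v2"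
    and det: "det2 w1 w2 = - det2 v1 v2"
  shows "mirror_symmetric \<Lambda>"
proof -
  obtain h where h: "linear_similarity 1 h" "h ` \<Lambda> = \<Lambda>" "h v1 = w1" "h v2 = w2"
    using superbase_linear_similarity[OF v w, of 1] eq by auto
  have "det (matrix h) * det2 v1 v2 = - det2 v1 v2"
    using det2_linear[of h v1 v2] h det by (simp add: linear_similarity_def)
  then have "(det (matrix h) + 1) * det2 v1 v2 = 0"
    by (simp add: distrib_right)
  then have "det (matrix h) = -1"
    using v by (simp add: superbase_iff)
  then show ?thesis
    using h mirror_symmetric_iff[OF superbase_planar_lattice[OF v]] by auto
qed

text \<open>Every degenerate case has a reversing symmetry: a zero conorm gives the flip of
  \<open>v1\<close>, and two equal conorms give the transposition of two superbase vectors that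
  exchanges them.\<close>

lemma not_mirror_symmetric_conorms:
  assumes v: "sorted_superbase \<Lambda> v0 v1 v2" and "\<not> mirror_symmetric \<Lambda>"
  shows "0 < conorm v1 v2" "conorm v1 v2 < conorm v0 v1" "conorm v0 v1 < conorm v0 v2"
proof -
  have sb: "superbase \<Lambda> v0 v1 v2"
    and le: "0 \<le> conorm v1 v2" "conorm v1 v2 \<le> conorm v0 v1" "conorm v0 v1 \<le> conorm v0 v2"
    using v by (simp_all add: sorted_superbase_def obtuse_superbase_def)
  then have v0: "v0 = - v1 - v2"
    by (simp add: superbase_iff)
  have "conorm v1 v2 \<noteq> 0"
  proof
    assume 0: "conorm v1 v2 = 0"
    from superbase_reversing_symmetry_imp_mirror_symmetric[OF sb superbase_flip[OF sb]] show False
      using 0 assms(2)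
      by (simp add: v0 conorm_def inner_diff_left inner_diff_right inner_commute[of v2 v1] det2_def)
  qed
  moreover have "conorm v1 v2 \<noteq> conorm v0 v1"
  proof
    assume e: "conorm v1 v2 = conorm v0 v1"
    have "superbase \<Lambda> v2 v1 v0"
      using superbase_swap01 superbase_swap12 sb by blast
    moreover have "conorm v1 v0 = conorm v1 v2" "conorm v2 v1 = conorm v0 v1" "conorm v2 v0 = conorm v0 v2"
      using e by (simp_all only: conorm_commute)
    moreover have "det2 v1 v0 = - det2 v1 v2"
      by (simp add: det2_def v0 algebra_simps)
    ultimately show False
      using superbase_reversing_symmetry_imp_mirror_symmetric[OF sb] assms(2) by blast
  qed
  moreover have "conorm v0 v1 \<noteq> conorm v0 v2"
  proof
    assume e: "conorm v0 v1 = conorm v0 v2"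
    from superbase_reversing_symmetry_imp_mirror_symmetric[OF sb superbase_swap12[OF sb]] show False
      using e assms(2) conorm_commute[of v1 v2] by (simp add: det2_def)
  qed
  ultimately show "0 < conorm v1 v2" "conorm v1 v2 < conorm v0 v1" "conorm v0 v1 < conorm v0 v2"
    using le by linarith+
qed

lemma lattice_sign_sorted_superbase:
  assumes v: "sorted_superbase \<Lambda> v0 v1 v2" and m: "\<not> mirror_symmetric \<Lambda>"
  shows "lattice_sign \<Lambda> = sgn (det2 v1 v2)"
proof -
  note less = not_mirror_symmetric_conorms[OF assms]
  have o: "obtuse_superbase \<Lambda> v0 v1 v2"
    using v by (simp add: sorted_superbase_def)
  then have v0: "v0 = - v1 - v2"
    by (simp add: obtuse_superbase_def superbase_iff)
  have norms: "norm v1 < norm v2" "norm v2 < norm v0"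
    using less unfolding norm_eq_sqrt_inner real_sqrt_less_iff conorm_sum_inner[OF v0] by simp_all
  have "(THE s. \<exists>v0 v1 v2. obtuse_superbase \<Lambda> v0 v1 v2 \<and> norm v1 < norm v2 \<and> norm v2 < norm v0 \<and>
      s = sgn (det (vector [v1, v2] :: real^2^2))) = sgn (det2 v1 v2)"
    unfolding det_vector_2
  proof (rule the_equality)
    show "\<exists>w0 w1 w2. obtuse_superbase \<Lambda> w0 w1 w2 \<and> norm w1 < norm w2 \<and> norm w2 < norm w0 \<and>
        sgn (det2 v1 v2) = sgn (det2 w1 w2)"
      using o norms by blast
  next
    fix s
    assume "\<exists>w0 w1 w2. obtuse_superbase \<Lambda> w0 w1 w2 \<and> norm w1 < norm w2 \<and> norm w2 < norm w0 \<and>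
        s = sgn (det2 w1 w2)"
    then show "s = sgn (det2 v1 v2)"
      using obtuse_superbases_det2_eq[OF o _ less] unfolding norm_eq_sqrt_inner real_sqrt_less_iff by metis
  qed
  then show ?thesis
    using m by (simp add: lattice_sign_def)
qed

lemma lattice_sign_eq_0_iff:
  assumes "planar_lattice \<Lambda>"
  shows "lattice_sign \<Lambda> = 0 \<longleftrightarrow> mirror_symmetric \<Lambda>"
proof (cases "mirror_symmetric \<Lambda>")
  case True
  then show ?thesis
    by (simp add: lattice_sign_def)
next
  case False
  obtain v0 v1 v2 where v: "sorted_superbase \<Lambda> v0 v1 v2"
    using sorted_superbase_exists[OF assms] .
  then have "det2 v1 v2 \<noteq> 0"
    by (simp add: sorted_superbase_def obtuse_superbase_def superbase_iff)
  then show ?thesis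
    using False lattice_sign_sorted_superbase[OF v False] by (simp add: sgn_zero_iff)
qed

lemma mirror_symmetric_linear_similarity:
  assumes L: "planar_lattice \<Lambda>" "planar_lattice (h ` \<Lambda>)" and h: "linear_similarity s h"
    and m: "mirror_symmetric \<Lambda>"
  shows "mirror_symmetric (h ` \<Lambda>)"
proof -
  obtain r where r: "linear_similarity 1 r" "det (matrix r) < 0" "r ` \<Lambda> = \<Lambda>"
    using m mirror_symmetric_iff[OF L(1)] by blast
  obtain k where k: "linear_similarity (1 / s) k" "\<And>x. k (h x) = x" "det (matrix k) * det (matrix h) = 1"
    using linear_similarity_inverse[OF h] by metis
  \<comment> \<open>A symmetry of the image lattice by conjugation; the scalings cancel and the
    determinant is unchanged.\<close>
  let ?g = "h \<circ> (r \<circ> k)"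
  have rk: "linear_similarity (1 / s) (r \<circ> k)"
    using linear_similarity_compose(1)[OF k(1) r(1)] by simp
  have "s > 0"
    using h by (simp add: linear_similarity_def)
  then have "linear_similarity 1 ?g"
    using linear_similarity_compose(1)[OF rk h] by simp
  moreover have "det (matrix ?g) = det (matrix h) * (det (matrix r) * det (matrix k))"
    using linear_similarity_compose(2)[OF rk h] linear_similarity_compose(2)[OF k(1) r(1)] by simp
  then have "det (matrix ?g) = det (matrix r)"
    using k(3) by (simp add: mult.commute mult.left_commute)
  moreover have "?g ` (h ` \<Lambda>) = h ` \<Lambda>"
    unfolding image_comp[symmetric] using r(3) by (simp add: image_image[of k h] k(2))
  ultimately show ?thesis
    using mirror_symmetric_iff[OF L(2)] r(2) by metis
qed

lemma lattice_sign_linear_similarity: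
  assumes L: "planar_lattice \<Lambda>" "planar_lattice (h ` \<Lambda>)" and h: "linear_similarity s h"
    and pos: "det (matrix h) > 0"
  shows "lattice_sign (h ` \<Lambda>) = lattice_sign \<Lambda>"
proof (cases "mirror_symmetric \<Lambda>")
  case True
  then show ?thesis
    using mirror_symmetric_linear_similarity[OF L h] by (simp add: lattice_sign_def)
next
  case False
  obtain k where k: "linear_similarity (1 / s) k" "\<And>x. k (h x) = x"
    using linear_similarity_inverse[OF h] by metis
  then have "k ` h ` \<Lambda> = \<Lambda>"
    by (simp add: image_image)
  then have nm: "\<not> mirror_symmetric (h ` \<Lambda>)"
    using mirror_symmetric_linear_similarity[OF L(2) _ k(1)] L(1) False by metis
  obtain v0 v1 v2 where v: "sorted_superbase \<Lambda> v0 v1 v2"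
    using sorted_superbase_exists[OF L(1)] .
  have "linear h"
    using h by (simp add: linear_similarity_def)
  then show ?thesis
    using lattice_sign_sorted_superbase[OF v False] pos
      lattice_sign_sorted_superbase[OF sorted_superbase_linear_similarity[OF h v] nm]
    by (simp add: det2_linear sgn_mult)
qed

lemma oriented_projected_invariant_eq_imp_linear_similarity:
  assumes L: "planar_lattice \<Lambda>" "planar_lattice \<Lambda>'"
    and eq: "projected_invariant \<Lambda> = projected_invariant \<Lambda>'" "lattice_sign \<Lambda> = lattice_sign \<Lambda>'"
  obtains s h where "linear_similarity s h" "det (matrix h) > 0" "h ` \<Lambda> = \<Lambda>'"
proof -
  obtain v0 v1 v2 w0 w1 w2 where v: "sorted_superbase \<Lambda> v0 v1 v2" and w: "sorted_superbase \<Lambda>' w0 w1 w2"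
    using sorted_superbase_exists L by metis
  obtain s h where h: "linear_similarity s h" "h ` \<Lambda> = \<Lambda>'" "h v1 = w1" "h v2 = w2"
    using projected_invariant_eq_imp_linear_similarity[OF v w eq(1)] .
  show ?thesis
  proof (cases "mirror_symmetric \<Lambda>'")
    case True
    show ?thesis
    proof (cases "det (matrix h) > 0")
      case True
      then show ?thesis
        using that h by blast
    next
      case False
      then have neg: "det (matrix h) < 0"
        using linear_similarity_det_nonzero[OF h(1)] by simp
      obtain r where r: "linear_similarity 1 r" "det (matrix r) < 0" "r ` \<Lambda>' = \<Lambda>'"
        using True mirror_symmetric_iff[OF L(2)] by blast
      have "linear_similarity s (r \<circ> h)" "det (matrix (r \<circ> h)) > 0"
        using linear_similarity_compose[OF h(1) r(1)] neg r(2) by (simp_all add: mult_neg_neg)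
      moreover have "(r \<circ> h) ` \<Lambda> = \<Lambda>'"
        unfolding image_comp[symmetric] h(2) r(3) ..
      ultimately show ?thesis
        using that by blast
    qed
  next
    case False
    \<comment> \<open>Sign 0 characterises mirror symmetry, so equal signs carry asymmetry from one
      lattice to the other.\<close>
    then have "\<not> mirror_symmetric \<Lambda>"
      using lattice_sign_eq_0_iff L eq(2) by metis
    then have "sgn (det2 v1 v2) = sgn (det2 w1 w2)"
      using lattice_sign_sorted_superbase v w False eq(2) by metis
    moreover have "det2 w1 w2 = det (matrix h) * det2 v1 v2"
      using det2_linear[of h v1 v2] h by (simp add: linear_similarity_def)
    moreover have "det2 v1 v2 \<noteq> 0"
      using v by (simp add: sorted_superbase_def obtuse_superbase_def superbase_iff)
    ultimately have "sgn (det (matrix h)) = 1"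
      by (simp add: sgn_mult sgn_zero_iff)
    then show ?thesis
      using that h by (simp add: sgn_1_pos)
  qed
qed

theorem corollary4p6:
  fixes \<Lambda> \<Lambda>' :: "(real^2) set"
  assumes "planar_lattice \<Lambda>" and "planar_lattice \<Lambda>'"
  shows "(similar_lattices \<Lambda> \<Lambda>' \<longleftrightarrow> projected_invariant \<Lambda> = projected_invariant \<Lambda>') \<and>
         (oriented_similar_lattices \<Lambda> \<Lambda>' \<longleftrightarrow>
            oriented_projected_invariant \<Lambda> = oriented_projected_invariant \<Lambda>')"
proof
  obtain v0 v1 v2 w0 w1 w2 where v: "sorted_superbase \<Lambda> v0 v1 v2" and w: "sorted_superbase \<Lambda>' w0 w1 w2"
    using sorted_superbase_exists assms by metis
  show "similar_lattices \<Lambda> \<Lambda>' \<longleftrightarrow> projected_invariant \<Lambda> = projected_invariant \<Lambda>'"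
    unfolding similar_lattices_iff[OF assms]
    using projected_invariant_linear_similarity[OF assms(1)]
      projected_invariant_eq_imp_linear_similarity[OF v w] by metis
  show "oriented_similar_lattices \<Lambda> \<Lambda>' \<longleftrightarrow>
      oriented_projected_invariant \<Lambda> = oriented_projected_invariant \<Lambda>'"
    unfolding oriented_similar_lattices_iff[OF assms] oriented_projected_invariant_def prod.inject
  proof
    assume "\<exists>s h. linear_similarity s h \<and> 0 < det (matrix h) \<and> h ` \<Lambda> = \<Lambda>'"
    then show "projected_invariant \<Lambda> = projected_invariant \<Lambda>' \<and> lattice_sign \<Lambda> = lattice_sign \<Lambda>'"
      using projected_invariant_linear_similarity[OF assms(1)]
        lattice_sign_linear_similarity[OF assms(1)] assms(2) by metis
  next
    assume "projected_invariant \<Lambda> = projected_invariant \<Lambda>' \<and> lattice_sign \<Lambda> = lattice_sign \<Lambda>'"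
    then show "\<exists>s h. linear_similarity s h \<and> 0 < det (matrix h) \<and> h ` \<Lambda> = \<Lambda>'"
      using oriented_projected_invariant_eq_imp_linear_similarity[OF assms] by metis
  qed
qed

end
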